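(* Let $q\in\mathbb C$ with $0<|q|<1$. Let $a,b,c,d,t$ be generic nonzero complex numbers (see context) and let $N$ be an integer, such that $$|q^{\frac{N+1}{2}}a^{-1}|<|t|<|q^{\frac{N-1}{2}}b|.$$ Then $$\sum_{m=-\infty}^\infty\oint \frac{(q^{1+m/2}/(az);q)_\infty\,(q^{1-m/2}z/b;q)_\infty}{(q^{m/2}cz;q)_\infty\,(q^{-m/2}d/z;q)_\infty}\;t^mz^{N-m}\;\frac{dz}{2\pi \mathrm i z} =t^N\,\frac{(q/(ab);q)_\infty\,(-q^{\frac{1+N}{2}}ct;q)_\infty\,(-q^{\frac{1-N}{2}}d/t;q)_\infty}{(cd;q)_\infty\,(-q^{\frac{1+N}{2}}/(at);q)_\infty\,(-q^{\frac{1-N}{2}}t/b;q)_\infty}.$$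
   Context: Notation: $(a;q)_\infty=\prod_{i=0}^\infty(1-aq^i)$. A square root $q^{1/2}$ of $q$ is fixed and all half-integer powers of $q$ are powers of it: $q^{n/2}=(q^{1/2})^n$ for $n\in\mathbb Z$. Genericity: the parameters are such that, for each $m$, the zeros of the denominator of the integrand split into a geometric sequence tending to $0$, namely $z=q^{-m/2+k}d$ ($k\ge 0$), and a geometric sequence tending to $\infty$, namely $z=q^{-m/2-k}/c$ ($k\geq 0$), with no point in common; that is, $cd\notin\{q^{-n}:n=0,1,2,\dots\}$. Contour: for each $m$, the integral is over a positively oriented closed contour in $\mathbb C\setminus\{0\}$ separating these two types of points: it has winding number $1$ around $0$ and around every point of the sequence tending to $0$, and winding number $0$ around every point of the sequence tending to $\infty$. *)

theory Defs
  imports "HOL-Complex_Analysis.Complex_Analysis"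
begin

text \<open>The infinite q-shifted factorial; the product converges for every \<open>a\<close> when \<open>norm q < 1\<close>
  (it is then \<open>0\<close> exactly when some factor vanishes).\<close>

definition qpoch_inf :: "complex \<Rightarrow> complex \<Rightarrow> complex" where
  "qpoch_inf a q = (\<Prod>i. 1 - a * q ^ i)"

text \<open>Throughout, \<open>r\<close> is the fixed square root of \<open>q\<close>, so that \<open>r powi n\<close> is the half-integer
  power of \<open>q\<close> with exponent \<open>n / 2\<close>.\<close>

definition inner_poles :: "complex \<Rightarrow> complex \<Rightarrow> complex \<Rightarrow> int \<Rightarrow> complex set" where
  "inner_poles q r d m = {r powi (- m) * q ^ k * d |k. True}"

definition outer_poles :: "complex \<Rightarrow> complex \<Rightarrow> complex \<Rightarrow> int \<Rightarrow> complex set" where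
  "outer_poles q r c m = {r powi (- m) * inverse (q ^ k) / c |k. True}"

text \<open>Since \<open>winding_number\<close> is only meaningful off the path, avoidance of \<open>0\<close> and of the points of
  \<open>A\<close> and \<open>B\<close> is required explicitly.\<close>

definition separating_contour :: "complex set \<Rightarrow> complex set \<Rightarrow> (real \<Rightarrow> complex) \<Rightarrow> bool" where
  "separating_contour A B \<gamma> \<longleftrightarrow>
     valid_path \<gamma> \<and> pathfinish \<gamma> = pathstart \<gamma> \<and>
     path_image \<gamma> \<inter> ({0} \<union> A \<union> B) = {} \<and>
     winding_number \<gamma> 0 = 1 \<and>
     (\<forall>w\<in>A. winding_number \<gamma> w = 1) \<and>
     (\<forall>w\<in>B. winding_number \<gamma> w = 0)"

end

theory Submission
  imports Defs
begin

text \<open>The substitution \<open>w = r powi m * z\<close> moves all integrals to one contour, on which only the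
  numerator depends on \<open>m\<close>. The bilateral sum \<open>S\<^sub>\<alpha>\<^sub>\<beta>(w)\<close> of the numerators, with \<open>\<alpha> = 1 / a\<close> and
  \<open>\<beta> = 1 / b\<close>, satisfies first-order recursions under \<open>\<alpha> \<mapsto> q \<alpha>\<close> and \<open>\<beta> \<mapsto> q \<beta>\<close>; iterating them shows
  that it is a constant multiple of the theta series \<open>S\<^sub>0\<^sub>0(w)\<close>. The integral of \<open>S\<^sub>0\<^sub>0\<close> against the kernel
  \<open>1 / ((c w; q) (d / w; q) w)\<close> satisfies first-order recursions under \<open>d \<mapsto> q d\<close> and \<open>c \<mapsto> q c\<close>, because
  \<open>S\<^sub>0\<^sub>0(q w)\<close> is \<open>S\<^sub>0\<^sub>0(w) / w\<close> up to a constant and the contour may be replaced by its image under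
  multiplication by \<open>q\<close>. Iterating these as well leaves the constant coefficient of \<open>S\<^sub>0\<^sub>0\<close>, which is
  \<open>t powi N\<close>.\<close>

section \<open>The q-shifted factorial\<close>

text \<open>The substitution turns \<open>z powi (N - m)\<close> into \<open>w powi (N - m)\<close>
  times the Gaussian factor \<open>r powi (m * m - N * m)\<close>. On either side of
  \<open>m = 0\<close> one numerator product grows like the inverse of \<open>r powi (m * m)\<close>
  up to geometric factors, so this growth cancels and the terms decay geometrically, with the ratios
  \<open>r powi (1 - N) * t / b\<close> and \<open>r powi (1 + N) / (a * t)\<close>. The two
  inequalities on \<open>t\<close> say that both ratios have modulus below 1; they yield convergence
  as well as the nonvanishing of the two denominators that contain \<open>t\<close>. Since the theta
  series is free of \<open>a\<close> and \<open>b\<close>, the right-hand side splits into a factor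
  from the sum and a factor from the integral. The delicate point is the interchange of limits:
  convergence must be uniform on the contour and in the parameters tending to 0, while the contour
  stays fixed. The latter is possible because replacing \<open>c\<close> by \<open>q * c\<close> or
  \<open>d\<close> by \<open>q * d\<close> only removes poles.\<close>

lemma norm_prod_one_minus_geometric_le:
  fixes q x :: complex
  assumes "norm q < 1"
  shows "norm (\<Prod>i<n. 1 - x * q ^ i) \<le> exp (norm x / (1 - norm q))"
proof -
  have "norm (\<Prod>i<n. 1 - x * q ^ i) \<le> (\<Prod>i<n. 1 + norm x * norm q ^ i)"
    unfolding prod_norm[symmetric]
    by (intro prod_mono) (auto simp: norm_mult norm_power intro: order_trans[OF norm_triangle_ineq4])
  also have "\<dots> \<le> exp (\<Sum>i<n. norm x * norm q ^ i)"
    by (intro prod_le_exp_sum) auto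
  also have "(\<Sum>i<n. norm x * norm q ^ i) \<le> (\<Sum>i. norm x * norm q ^ i)"
    using assms by (intro sum_le_suminf summable_mult summable_geometric) auto
  also have "\<dots> = norm x / (1 - norm q)"
    using assms by (subst suminf_mult) (auto simp: suminf_geometric summable_geometric)
  finally show ?thesis by simp
qed

context
  fixes q :: complex
  assumes q1: "norm q < 1"
begin

lemma qpoch_inf_convergent: "convergent_prod (\<lambda>i. 1 - x * q ^ i)"
  using q1
  by (intro abs_convergent_prod_imp_convergent_prod summable_imp_abs_convergent_prod)
     (auto simp: norm_mult norm_power intro!: summable_mult summable_geometric)

lemma qpoch_inf_LIMSEQ: "(\<lambda>n. \<Prod>i<n. 1 - x * q ^ i) \<longlonglongrightarrow> qpoch_inf x q"
  unfolding qpoch_inf_def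
  by (subst LIMSEQ_lessThan_iff_atMost) (rule convergent_prod_LIMSEQ[OF qpoch_inf_convergent])

lemma qpoch_inf_step: "qpoch_inf x q = (1 - x) * qpoch_inf (q * x) q"
proof (rule LIMSEQ_unique)
  show "(\<lambda>n. \<Prod>i<Suc n. 1 - x * q ^ i) \<longlonglongrightarrow> qpoch_inf x q"
    using qpoch_inf_LIMSEQ by (rule LIMSEQ_Suc)
  have "(\<Prod>i<Suc n. 1 - x * q ^ i) = (1 - x) * (\<Prod>i<n. 1 - q * x * q ^ i)" for n
    by (subst prod.lessThan_Suc_shift) (simp add: mult_ac)
  then show "(\<lambda>n. \<Prod>i<Suc n. 1 - x * q ^ i) \<longlonglongrightarrow> (1 - x) * qpoch_inf (q * x) q"
    by (simp only:) (intro tendsto_intros qpoch_inf_LIMSEQ)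
qed

lemma qpoch_inf_0 [simp]: "qpoch_inf 0 q = 1"
  by (simp add: qpoch_inf_def)

text \<open>Convergence of an infinite product includes a nonzero limit once finitely many factors
  are dropped, so the product can vanish only through one of its factors. The poles of the
  integrands are read off from this.\<close>

lemma qpoch_inf_eq_0_iff: "qpoch_inf x q = 0 \<longleftrightarrow> (\<exists>k. x * q ^ k = 1)"
proof
  show "\<exists>k. x * q ^ k = 1" if "qpoch_inf x q = 0"
    using that prodinf_nonzero[OF qpoch_inf_convergent[of x]] unfolding qpoch_inf_def by fastforce
  assume "\<exists>k. x * q ^ k = 1"
  then obtain k where k: "x * q ^ k = 1" ..
  have "\<forall>\<^sub>F n in sequentially. (\<Prod>i<n. 1 - x * q ^ i) = 0"
    using eventually_gt_at_top[of k] by eventually_elim (use k in \<open>auto intro!: bexI[of _ k]\<close>)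
  then have "(\<lambda>n. \<Prod>i<n. 1 - x * q ^ i) \<longlonglongrightarrow> 0"
    by (rule tendsto_eventually)
  with qpoch_inf_LIMSEQ show "qpoch_inf x q = 0"
    by (rule LIMSEQ_unique)
qed

lemma qpoch_inf_nonzero: "norm x < 1 \<Longrightarrow> qpoch_inf x q \<noteq> 0"
proof
  assume x: "norm x < 1" and "qpoch_inf x q = 0"
  then obtain k where "x * q ^ k = 1" by (auto simp: qpoch_inf_eq_0_iff)
  then have "norm x * norm q ^ k = 1" by (metis norm_mult norm_one norm_power)
  moreover have "norm x * norm q ^ k \<le> norm x"
    using q1 by (intro mult_right_le_one_le) (auto simp: power_le_one)
  ultimately show False using x by simp
qed

lemma norm_qpoch_inf_le: "norm (qpoch_inf x q) \<le> exp (norm x / (1 - norm q))"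
  using norm_prod_one_minus_geometric_le[OF q1]
  by (intro LIMSEQ_le_const2[OF tendsto_norm[OF qpoch_inf_LIMSEQ[of x]]]) auto

lemma qpoch_inf_holomorphic: "(\<lambda>x. qpoch_inf x q) holomorphic_on UNIV"
proof (rule holomorphic_uniform_sequence[of UNIV "\<lambda>n x. \<Prod>i<n. 1 - x * q ^ i"])
  fix x :: complex
  have "uniformly_convergent_on (cball x 1) (\<lambda>n y. \<Sum>i<n. norm ((1 - y * q ^ i) - 1))"
  proof (rule Weierstrass_m_test'[of _ _ "\<lambda>i. (norm x + 1) * norm q ^ i"])
    show "summable (\<lambda>i. (norm x + 1) * norm q ^ i)"
      using q1 by (intro summable_mult summable_geometric) auto
    fix i y assume "y \<in> cball x 1"
    then have "norm y \<le> norm x + 1"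
      using norm_triangle_ineq4[of x "x - y"] by (simp add: dist_norm)
    then show "norm (norm (1 - y * q ^ i - 1)) \<le> (norm x + 1) * norm q ^ i"
      by (auto simp: norm_mult norm_power intro!: mult_right_mono)
  qed
  then have "uniformly_convergent_on (cball x 1) (\<lambda>n y. \<Prod>i<n. 1 - y * q ^ i)"
    by (intro uniformly_convergent_on_prod') (auto intro!: continuous_intros)
  moreover have "lim (\<lambda>n. \<Prod>i<n. 1 - y * q ^ i) = qpoch_inf y q" for y
    using qpoch_inf_LIMSEQ by (rule limI)
  ultimately have "uniform_limit (cball x 1) (\<lambda>n y. \<Prod>i<n. 1 - y * q ^ i) (\<lambda>y. qpoch_inf y q) sequentially"
    by (simp add: uniformly_convergent_uniform_limit_iff)
  then show "\<exists>d>0. cball x d \<subseteq> UNIV \<and>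
      uniform_limit (cball x d) (\<lambda>n y. \<Prod>i<n. 1 - y * q ^ i) (\<lambda>y. qpoch_inf y q) sequentially"
    by (intro exI[of _ 1]) auto
qed (auto intro!: holomorphic_intros)

lemma holomorphic_on_qpoch_inf [holomorphic_intros]:
  "f holomorphic_on A \<Longrightarrow> (\<lambda>x. qpoch_inf (f x) q) holomorphic_on A"
  using holomorphic_on_compose_gen[OF _ qpoch_inf_holomorphic, of f A] by (simp add: o_def)

lemma continuous_on_qpoch_inf [continuous_intros]:
  assumes "continuous_on A f"
  shows "continuous_on A (\<lambda>x. qpoch_inf (f x) q)"
  using continuous_on_compose2[OF holomorphic_on_imp_continuous_on[OF qpoch_inf_holomorphic] assms] by simp

lemma tendsto_qpoch_inf_0:
  assumes "(f \<longlongrightarrow> 0) F"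
  shows "((\<lambda>x. qpoch_inf (f x) q) \<longlongrightarrow> 1) F"
proof -
  have "isCont (\<lambda>x. qpoch_inf x q) 0"
    using continuous_on_qpoch_inf[OF continuous_on_id, of UNIV]
    by (simp add: continuous_on_eq_continuous_at)
  from isCont_tendsto_compose[OF this assms] show ?thesis by simp
qed

text \<open>Each of the \<open>n\<close> factors of modulus greater than one is \<open>q\<^sup>-\<^sup>j y\<close> up to a factor
  \<open>1 + O(q\<^sup>j)\<close>; this is what makes the bilateral series converge.\<close>

lemma norm_qpoch_inf_powi_le:
  assumes "q \<noteq> 0" "norm y \<le> Y" "0 < Y" and s: "norm q = s\<^sup>2" "0 < s"
  shows "norm (qpoch_inf (q powi (1 - int n) * y) q)
           \<le> Y ^ n * s powi (- int (n * (n - 1))) * exp ((Y + 1 / Y) / (1 - norm q))"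
proof -
  \<comment> \<open>Each step peels off one factor. The base case is the tail, whose arguments have
    modulus at most \<open>Y\<close>; the sum in the last exponential collects the corrections
    \<open>1 + norm q ^ j / Y\<close> and stays below a geometric series.\<close>
  have "norm (qpoch_inf (q powi (1 - int n) * y) q)
           \<le> Y ^ n * s powi (- int (n * (n - 1))) * exp (Y / (1 - norm q))
              * exp (\<Sum>j<n. norm q ^ j / Y)"
  proof (induction n)
    case 0
    have "norm (qpoch_inf (q * y) q) \<le> exp (norm (q * y) / (1 - norm q))"
      by (rule norm_qpoch_inf_le)
    also have "norm (q * y) \<le> 1 * Y"
      unfolding norm_mult using assms q1 by (intro mult_mono) auto
    finally show ?case using q1 by (simp add: divide_right_mono)
  next
    case (Suc n)
    let ?x = "q powi (- int n) * y"
    have qx: "q * ?x = q powi (1 - int n) * y"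
      using \<open>q \<noteq> 0\<close> by (simp add: power_int_diff power_int_minus field_simps)
    then have eq: "qpoch_inf (q powi (1 - int (Suc n)) * y) q
                     = (1 - ?x) * qpoch_inf (q powi (1 - int n) * y) q"
      using qpoch_inf_step[of ?x] unfolding qx by simp
    have "norm (1 - ?x) \<le> 1 + norm ?x"
      using norm_triangle_ineq4[of 1 ?x] by simp
    also have "norm ?x \<le> s powi (- 2 * int n) * Y"
    proof -
      have "norm (q powi (- int n)) = s powi (- 2 * int n)"
        using power_int_mult[of s 2 "- int n"] by (simp add: norm_power_int s)
      then show ?thesis using assms by (simp add: norm_mult mult_left_mono)
    qed
    also have "1 + s powi (- 2 * int n) * Y = Y * s powi (- 2 * int n) * (1 + norm q ^ n / Y)"
    proof -
      have "s powi (- 2 * int n) * norm q ^ n = 1"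
        using s by (simp add: power_int_minus power_int_mult)
      then show ?thesis using \<open>0 < Y\<close> by (simp add: distrib_left)
    qed
    also have "\<dots> \<le> Y * s powi (- 2 * int n) * exp (norm q ^ n / Y)"
      using assms by (intro mult_left_mono) auto
    finally have "norm (1 - ?x) \<le> Y * s powi (- 2 * int n) * exp (norm q ^ n / Y)" by simp
    then have "norm (qpoch_inf (q powi (1 - int (Suc n)) * y) q)
       \<le> (Y * s powi (- 2 * int n) * exp (norm q ^ n / Y)) *
         (Y ^ n * s powi (- int (n * (n - 1))) * exp (Y / (1 - norm q))
              * exp (\<Sum>j<n. norm q ^ j / Y))"
      unfolding eq norm_mult by (intro mult_mono Suc.IH) (use assms in auto)
    also have "\<dots> = (Y * Y ^ n) * (s powi (- 2 * int n) * s powi (- int (n * (n - 1))))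
         * exp (Y / (1 - norm q)) * (exp (norm q ^ n / Y) * exp (\<Sum>j<n. norm q ^ j / Y))"
      by (simp only: mult_ac)
    \<comment> \<open>The exponents add up by 2n + n(n - 1) = (n + 1)n; the case
      \<open>n = 0\<close> is split off because \<open>n - 1\<close> is truncated there.\<close>
    also have "s powi (- 2 * int n) * s powi (- int (n * (n - 1))) = s powi (- int (Suc n * (Suc n - 1)))"
      by (subst power_int_add[symmetric]) (use s in \<open>auto, cases n, auto simp: algebra_simps\<close>)
    finally show ?case by (simp add: exp_add mult_ac)
  qed
  also have "\<dots> \<le> Y ^ n * s powi (- int (n * (n - 1))) * exp (Y / (1 - norm q))
              * exp (1 / Y / (1 - norm q))"
  proof -
    have "(\<Sum>j<n. norm q ^ j / Y) = (\<Sum>j<n. norm q ^ j) / Y" by (simp add: sum_divide_distrib)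
    also have "\<dots> \<le> (\<Sum>j. norm q ^ j) / Y"
      using assms q1 by (intro divide_right_mono sum_le_suminf summable_geometric) auto
    also have "\<dots> = 1 / Y / (1 - norm q)" using q1 by (simp add: suminf_geometric)
    finally show ?thesis using assms by (intro mult_left_mono) auto
  qed
  also have "\<dots> = Y ^ n * s powi (- int (n * (n - 1))) * exp ((Y + 1 / Y) / (1 - norm q))"
    by (simp add: exp_add add_divide_distrib)
  finally show ?thesis .
qed

end

section \<open>Contours separating the poles\<close>

text \<open>Cauchy's theorem in homology form concerns one closed path, so \<open>g\<close> and the
  reversed \<open>h\<close> are joined by a path \<open>p\<close> inside \<open>S\<close>, run forth
  and back. The contributions of \<open>p\<close> cancel, and around every point outside
  \<open>S\<close> the joined loop has winding number 0.\<close>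

lemma contour_integral_eq_if_winding_number_eq:
  assumes S: "open S" "connected S" and f: "f holomorphic_on S"
    and g: "valid_path g" "pathfinish g = pathstart g" "path_image g \<subseteq> S"
    and h: "valid_path h" "pathfinish h = pathstart h" "path_image h \<subseteq> S"
    and winding: "\<And>w. w \<notin> S \<Longrightarrow> winding_number g w = winding_number h w"
  shows "contour_integral g f = contour_integral h f"
proof -
  have "pathstart g \<in> S" "pathstart h \<in> S"
    using g h pathstart_in_path_image by blast+
  from connected_open_polynomial_connected[OF S this] obtain p where
    p: "polynomial_function p" "path_image p \<subseteq> S" "pathstart p = pathstart g" "pathfinish p = pathstart h"
    by blast
  have vp: "valid_path p" using p by (simp add: valid_path_polynomial_function)
  define \<sigma> where "\<sigma> = g +++ (p +++ (reversepath h +++ reversepath p))"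
  have paths: "path g" "path p" "path h"
    using g h vp by (auto intro: valid_path_imp_path)
  have "(f has_contour_integral 0) \<sigma>"
  proof (rule Cauchy_theorem_global[OF S(1) f])
    show "valid_path \<sigma>" "pathfinish \<sigma> = pathstart \<sigma>" "path_image \<sigma> \<subseteq> S"
      using g h p vp by (auto simp: \<sigma>_def path_image_join intro!: valid_path_join)
    show "winding_number \<sigma> w = 0" if "w \<notin> S" for w
    proof -
      have w: "w \<notin> path_image g" "w \<notin> path_image p" "w \<notin> path_image h"
        using that g h p by auto
      then show ?thesis
        using paths g h p winding[OF that]
        by (simp add: \<sigma>_def winding_number_join winding_number_reversepath path_image_join)
    qed
  qed
  then have "contour_integral \<sigma> f = 0"
    by (rule contour_integral_unique)
  moreover have "f contour_integrable_on g" "f contour_integrable_on h" "f contour_integrable_on p"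
    using f S g h p vp by (auto intro!: contour_integrable_holomorphic_simple)
  ultimately show ?thesis
    using g h vp p by (simp add: \<sigma>_def contour_integral_reversepath contour_integrable_reversepath)
qed

section \<open>Dilations of contours\<close>

lemma contour_integral_scale:
  assumes "valid_path g"
  shows "contour_integral (\<lambda>x. l * g x) f = contour_integral g (\<lambda>w. l * f (l * w))"
proof -
  have "(\<lambda>w. l * w) analytic_on UNIV" by (intro analytic_intros)
  from contour_integral_comp_analyticW[OF this assms, of f] show ?thesis
    by (simp add: o_def)
qed

lemma valid_path_scale:
  fixes l :: complex
  assumes "valid_path g"
  shows "valid_path (\<lambda>x. l * g x)"
proof -
  have "(\<lambda>w. l * w) holomorphic_on UNIV" by (intro holomorphic_intros)
  from valid_path_compose_holomorphic[OF assms this] show ?thesis by (simp add: o_def)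
qed

lemma path_image_scale: "path_image (\<lambda>x. l * g x) = (*) l ` path_image g"
  by (auto simp: path_image_def)

lemma winding_number_scale:
  assumes "valid_path g" "l \<noteq> 0" "w \<notin> path_image g"
  shows "winding_number (\<lambda>x. l * g x) (l * w) = winding_number g w"
proof -
  have "l * w \<notin> path_image (\<lambda>x. l * g x)"
    using assms by (auto simp: path_image_scale)
  moreover have "l * (1 / (l * z - l * w)) = 1 / (z - w)" for z
    using \<open>l \<noteq> 0\<close> by (simp flip: right_diff_distrib)
  ultimately show ?thesis
    using assms by (simp add: winding_number_valid_path valid_path_scale contour_integral_scale)
qed

text \<open>The derivative is continuous on a compact interval. The bound is what carries a uniform
  limit through a contour integral.\<close>

lemma polynomial_function_vector_derivative_bounded:
  fixes p :: "real \<Rightarrow> 'a::euclidean_space"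
  assumes "polynomial_function p"
  obtains B where "\<And>t. t \<in> {0..1} \<Longrightarrow> norm (vector_derivative p (at t)) \<le> B"
proof -
  obtain p' where p': "polynomial_function p'" "\<And>x. (p has_vector_derivative p' x) (at x)"
    using has_vector_derivative_polynomial_function[OF assms] by metis
  then have "bounded (p' ` {0..1})"
    by (intro compact_imp_bounded compact_continuous_image continuous_on_polymonial_function) auto
  moreover have "vector_derivative p (at t) = p' t" for t
    using p'(2) by (rule vector_derivative_at)
  ultimately show ?thesis using that unfolding bounded_iff by (metis imageI)
qed

section \<open>Contours separating the zeros of two q-shifted factorials\<close>

context
  fixes q :: complex
  assumes q0: "q \<noteq> 0" and q1: "norm q < 1"
begin

text \<open>The zero sets of \<open>qpoch_inf (d / w)\<close> and \<open>qpoch_inf (c * w)\<close> are the inner and the outer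
  poles, so \<open>c = 0\<close> or \<open>d = 0\<close> means that there are no poles of that kind.\<close>

definition regular_set :: "complex \<Rightarrow> complex \<Rightarrow> complex set" where
  "regular_set c d = {w. w \<noteq> 0 \<and> qpoch_inf (c * w) q \<noteq> 0 \<and> qpoch_inf (d / w) q \<noteq> 0}"

text \<open>Since \<open>d / 0 = 0\<close> and \<open>qpoch_inf 0 q = 1\<close>, the origin is not
  covered by the last two conditions; its winding number is therefore prescribed separately.\<close>

definition separates :: "complex \<Rightarrow> complex \<Rightarrow> (real \<Rightarrow> complex) \<Rightarrow> bool" where
  "separates c d g \<longleftrightarrow> valid_path g \<and> pathfinish g = pathstart g \<and> path_image g \<subseteq> regular_set c d \<and>
     winding_number g 0 = 1 \<and>
     (\<forall>w. qpoch_inf (d / w) q = 0 \<longrightarrow> winding_number g w = 1) \<and>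
     (\<forall>w. qpoch_inf (c * w) q = 0 \<longrightarrow> winding_number g w = 0)"

lemma separates_regular: "separates c d g \<Longrightarrow> w \<in> path_image g \<Longrightarrow> w \<in> regular_set c d"
  by (auto simp: separates_def)

text \<open>The inner poles accumulate only at 0, which is removed. Writing the set as a preimage
  under a map continuous off 0 avoids any discussion of accumulation points.\<close>

lemma open_regular_set: "open (regular_set c d)"
proof -
  have "regular_set c d = {w \<in> -{0}. qpoch_inf (c * w) q * qpoch_inf (d / w) q \<in> -{0}}"
    by (auto simp: regular_set_def)
  also have "\<dots> = -{0} \<inter> (\<lambda>w. qpoch_inf (c * w) q * qpoch_inf (d / w) q) -` (-{0})"
    by auto
  also have "open \<dots>"
    by (intro continuous_open_preimage continuous_on_mult continuous_on_qpoch_inf[OF q1]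
          continuous_intros open_Compl) auto
  finally show ?thesis .
qed

text \<open>Only countably many points are removed, and the plane without a countable set is
  connected.\<close>

lemma connected_regular_set: "connected (regular_set c d)"
proof -
  let ?B = "insert 0 (range (\<lambda>k. 1 / (c * q ^ k)) \<union> range (\<lambda>k. d * q ^ k))"
  have "w \<in> ?B" if w: "w \<notin> regular_set c d" for w
  proof -
    consider "w = 0" | k where "c * w * q ^ k = 1" | k where "w \<noteq> 0" "d / w * q ^ k = 1"
      using w by (auto simp: regular_set_def qpoch_inf_eq_0_iff[OF q1])
    then show ?thesis
    proof cases
      case (2 k)
      then have "w = 1 / (c * q ^ k)" by (metis mult.assoc mult.commute mult_eq_0_iff nonzero_eq_divide_eq zero_neq_one)
      then show ?thesis by blast
    next
      case (3 k)
      then have "w = d * q ^ k" by (auto simp: field_simps)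
      then show ?thesis by blast
    qed auto
  qed
  then have "- regular_set c d \<subseteq> ?B" by blast
  then have "countable (- regular_set c d)"
    by (rule countable_subset) auto
  from connected_open_diff_countable[OF _ _ _ this, of UNIV] show ?thesis
    by (simp add: Diff_eq connected_UNIV)
qed

text \<open>A point off the regular set is 0 or a zero of one of the two factors, and
  \<open>separates\<close> prescribes the winding number at each of these; hence the two contours
  agree wherever the Cauchy argument asks for it.\<close>

lemma separates_contour_integral_eq:
  assumes "separates c d g" "separates c d h" "f holomorphic_on regular_set c d"
  shows "contour_integral g f = contour_integral h f"
proof (rule contour_integral_eq_if_winding_number_eq[OF open_regular_set connected_regular_set])
  show "winding_number g w = winding_number h w" if "w \<notin> regular_set c d" for w
    using assms(1,2) that by (auto simp: separates_def regular_set_def)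
qed (use assms in \<open>auto simp: separates_def\<close>)

text \<open>The quantities \<open>c * w\<close> and \<open>d / w\<close> are unchanged when
  \<open>w\<close>, \<open>c\<close>, \<open>d\<close> become \<open>l * w\<close>,
  \<open>c / l\<close>, \<open>l * d\<close>, so both pole sequences move along with the contour.
  Powers of \<open>r\<close> give the substitution, \<open>q\<close> and \<open>1 / q\<close> the
  recursions.\<close>

lemma separates_scale:
  assumes "separates c d g" "l \<noteq> 0"
  shows "separates (c / l) (l * d) (\<lambda>x. l * g x)"
proof -
  note g = assms(1)[unfolded separates_def]
  have wind: "winding_number (\<lambda>x. l * g x) w = winding_number g (w / l)"
    if "w / l \<notin> regular_set c d" for w
    using winding_number_scale[of g l "w / l"] g that \<open>l \<noteq> 0\<close> by auto
  show ?thesis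
    unfolding separates_def
  proof (intro conjI allI impI)
    show "winding_number (\<lambda>x. l * g x) 0 = 1"
      using wind[of 0] g by (simp add: regular_set_def)
    show "winding_number (\<lambda>x. l * g x) w = 1" if "qpoch_inf (l * d / w) q = 0" for w
      using wind[of w] g that \<open>l \<noteq> 0\<close> by (simp add: regular_set_def mult.commute)
    show "winding_number (\<lambda>x. l * g x) w = 0" if "qpoch_inf (c / l * w) q = 0" for w
      using wind[of w] g that \<open>l \<noteq> 0\<close> by (simp add: regular_set_def)
    show "path_image (\<lambda>x. l * g x) \<subseteq> regular_set (c / l) (l * d)"
      using g \<open>l \<noteq> 0\<close> by (auto simp: path_image_scale regular_set_def)
  qed (use g in \<open>auto simp: valid_path_scale pathfinish_def pathstart_def\<close>)
qed

lemma qpoch_inf_mult_q_eq_0: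
  assumes "qpoch_inf (q * x) q = 0"
  shows "qpoch_inf x q = 0"
  by (subst qpoch_inf_step[OF q1]) (simp add: assms)

lemma qpoch_inf_mult_q_eq_0':
  "qpoch_inf (q * c * w) q = 0 \<Longrightarrow> qpoch_inf (c * w) q = 0"
  "qpoch_inf (q * d / w) q = 0 \<Longrightarrow> qpoch_inf (d / w) q = 0"
  using qpoch_inf_mult_q_eq_0[of "c * w"] qpoch_inf_mult_q_eq_0[of "d / w"] by (simp_all add: mult.assoc)

lemma regular_set_mult_q:
  "regular_set c d \<subseteq> regular_set (q * c) d" "regular_set c d \<subseteq> regular_set c (q * d)"
  unfolding regular_set_def using qpoch_inf_mult_q_eq_0' by blast+

text \<open>Multiplying \<open>c\<close> or \<open>d\<close> by \<open>q\<close> deletes the first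
  point of one pole sequence and adds none, so one contour serves for the whole iteration.\<close>

lemma separates_mult_q:
  assumes "separates c d g"
  shows "separates (q * c) d g" "separates c (q * d) g"
  using assms regular_set_mult_q[of c d] qpoch_inf_mult_q_eq_0' unfolding separates_def by blast+

lemma separates_0:
  assumes "separates c d g"
  shows "separates 0 d g" "separates c 0 g"
  using assms by (auto simp: separates_def regular_set_def qpoch_inf_0[OF q1])

text \<open>A valid path may have an unbounded derivative, which obstructs exchanging limits and contour
  integrals; a polynomial path does not.\<close>

lemma separates_polynomial_function:
  assumes "separates c d g"
  obtains p where "polynomial_function p" "separates c d p"
proof -
  note g = assms[unfolded separates_def]
  have "path g" using g valid_path_imp_path by blast
  then obtain e where e: "e > 0" "\<forall>h k. valid_path h \<and> valid_path k \<and>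
        (\<forall>t\<in>{0..1}. norm (h t - g t) < e \<and> norm (k t - g t) < e) \<and>
        pathfinish h = pathstart h \<and> pathfinish k = pathstart k \<longrightarrow>
      path_image h \<subseteq> regular_set c d \<and> path_image k \<subseteq> regular_set c d \<and>
      (\<forall>f. f holomorphic_on regular_set c d \<longrightarrow> contour_integral k f = contour_integral h f)"
    using contour_integral_nearby_loops[OF open_regular_set, of g c d] g by blast
  obtain p where p: "polynomial_function p" "pathstart p = pathstart g" "pathfinish p = pathfinish g"
    "\<And>t. t \<in> {0..1} \<Longrightarrow> norm (p t - g t) < e"
    using path_approx_polynomial_function[OF \<open>path g\<close> \<open>e > 0\<close>] by blast
  have vp: "valid_path p" using p by (simp add: valid_path_polynomial_function)
  have gp: "path_image p \<subseteq> regular_set c d"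
    "\<And>f. f holomorphic_on regular_set c d \<Longrightarrow> contour_integral p f = contour_integral g f"
    using e(2)[rule_format, of g p] e(1) p vp g by auto
  \<comment> \<open>Up to a constant a winding number is the integral of \<open>1 / (z - w)\<close>,
    which is holomorphic on the regular set when \<open>w\<close> lies outside it. Hence a single
    approximation preserves all prescribed winding numbers at once.\<close>
  have "winding_number p w = winding_number g w" if w: "w \<notin> regular_set c d" for w
  proof -
    have "(\<lambda>z. 1 / (z - w)) holomorphic_on regular_set c d"
      using w by (auto intro!: holomorphic_intros)
    from gp(2)[OF this] show ?thesis
      using w g vp gp(1) by (subst (1 2) winding_number_valid_path) auto
  qed
  with g p vp gp have "separates c d p" by (auto simp: separates_def regular_set_def)
  with p show ?thesis by (intro that)
qed

text \<open>The left side is the integral of \<open>f\<close> over the dilated contour. The second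
  hypothesis says that this contour also separates the poles for \<open>c\<close> and
  \<open>d\<close>, so none of them is crossed.\<close>

lemma separates_contour_integral_shift:
  assumes "separates c d g" "separates (l * c) (d / l) g" "l \<noteq> 0" "f holomorphic_on regular_set c d"
  shows "contour_integral g (\<lambda>w. l * f (l * w)) = contour_integral g f"
proof -
  have "contour_integral g (\<lambda>w. l * f (l * w)) = contour_integral (\<lambda>x. l * g x) f"
    using assms by (intro contour_integral_scale[symmetric]) (auto simp: separates_def)
  also have "\<dots> = contour_integral g f"
    using separates_scale[OF assms(2,3)] assms
    by (intro separates_contour_integral_eq[of c d]) auto
  finally show ?thesis .
qed

end

section \<open>The bilateral series\<close>

text \<open>The recursion telescopes in multiplied form, without division, so vanishing factors do
  no harm. With \<open>x = 0\<close> or \<open>y = 0\<close> one of the products is 1.\<close>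

lemma qpoch_inf_recursion:
  assumes q1: "norm q < 1" and step: "\<And>n. (1 - x * q ^ n) * f n = (1 - y * q ^ n) * f (Suc n)"
    and lim: "f \<longlonglongrightarrow> L"
  shows "qpoch_inf x q * f 0 = qpoch_inf y q * L"
proof (rule LIMSEQ_unique)
  have "(\<Prod>i<n. 1 - x * q ^ i) * f 0 = (\<Prod>i<n. 1 - y * q ^ i) * f n" for n
  proof (induction n)
    case (Suc n)
    have "(\<Prod>i<Suc n. 1 - x * q ^ i) * f 0 = (1 - x * q ^ n) * ((\<Prod>i<n. 1 - x * q ^ i) * f 0)"
      by simp
    also have "\<dots> = (\<Prod>i<n. 1 - y * q ^ i) * ((1 - x * q ^ n) * f n)"
      unfolding Suc.IH by (simp only: mult_ac)
    finally show ?case unfolding step by simp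
  qed simp
  then show "(\<lambda>n. (\<Prod>i<n. 1 - x * q ^ i) * f 0) \<longlonglongrightarrow> qpoch_inf y q * L"
    by (simp only:) (intro tendsto_intros qpoch_inf_LIMSEQ[OF q1] lim)
  show "(\<lambda>n. (\<Prod>i<n. 1 - x * q ^ i) * f 0) \<longlonglongrightarrow> qpoch_inf x q * f 0"
    by (intro tendsto_intros qpoch_inf_LIMSEQ[OF q1])
qed

section \<open>Majorants over the integers\<close>

definition two_sided_geometric :: "real \<Rightarrow> real \<Rightarrow> int \<Rightarrow> real" where
  "two_sided_geometric x y m = (if 0 \<le> m then x ^ nat m else y ^ nat (- m))"

lemma summable_two_sided_geometric:
  assumes "0 \<le> x" "x < 1" "0 \<le> y" "y < 1"
  shows "two_sided_geometric x y summable_on UNIV"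
proof -
  have geo: "(\<lambda>n. z ^ n) summable_on UNIV" if "0 \<le> z" "z < 1" for z :: real
    using that by (intro summable_nonneg_imp_summable_on) (auto intro!: summable_geometric)
  have "two_sided_geometric x y summable_on range int"
    using geo[of x] assms by (subst summable_on_reindex) (auto simp: o_def two_sided_geometric_def)
  moreover have "two_sided_geometric x y summable_on range (\<lambda>n. - int n)"
  proof (subst summable_on_reindex)
    have "two_sided_geometric x y \<circ> (\<lambda>n. - int n) = (\<lambda>n. y ^ n)"
      by (auto simp: two_sided_geometric_def)
    then show "(two_sided_geometric x y \<circ> (\<lambda>n. - int n)) summable_on UNIV"
      using geo[of y] assms by simp
  qed (auto simp: inj_on_def)
  ultimately have "two_sided_geometric x y summable_on (range int \<union> range (\<lambda>n. - int n))"
    by (rule summable_on_union)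
  also have "range int \<union> range (\<lambda>n. - int n) = UNIV"
  proof -
    have "m \<in> range int \<union> range (\<lambda>n. - int n)" for m
      by (cases m rule: int_cases2) auto
    then show ?thesis by auto
  qed
  finally show ?thesis .
qed

context
  fixes q r t :: complex and N :: int
  assumes q0: "q \<noteq> 0" and q1: "norm q < 1" and rq: "r\<^sup>2 = q" and t0: "t \<noteq> 0"
begin

text \<open>The power of \<open>r\<close> is what \<open>z powi (N - m)\<close> sheds under
  \<open>z = r powi (- m) * w\<close>. The reciprocals of \<open>a\<close> and \<open>b\<close>
  serve as parameters so that the limit value 0 is allowed.\<close>

definition series_term :: "complex \<Rightarrow> complex \<Rightarrow> int \<Rightarrow> complex \<Rightarrow> complex" where
  "series_term \<alpha> \<beta> m w =
     qpoch_inf (q powi (1 + m) * (\<alpha> / w)) q * qpoch_inf (q powi (1 - m) * (\<beta> * w)) q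
     * (t powi m * r powi (m * m - N * m) * w powi (N - m))"

definition series_sum :: "complex \<Rightarrow> complex \<Rightarrow> complex \<Rightarrow> complex" where
  "series_sum \<alpha> \<beta> w = (\<Sum>\<^sub>\<infinity>m. series_term \<alpha> \<beta> m w)"

text \<open>The condition on \<open>t\<close>, which also makes sense for \<open>\<alpha> = 0\<close> or \<open>\<beta> = 0\<close>.\<close>

definition admissible :: "complex \<Rightarrow> complex \<Rightarrow> bool" where
  "admissible \<alpha> \<beta> \<longleftrightarrow> norm (r powi (1 + N) * \<alpha> / t) < 1 \<and> norm (r powi (1 - N) * \<beta> * t) < 1"

text \<open>The exponent adds up the bounds for both signs of \<open>m\<close>, so that one
  continuous function of the modulus \<open>R\<close> of \<open>w\<close> serves all terms.\<close>

definition majorant :: "real \<Rightarrow> real \<Rightarrow> real \<Rightarrow> real" where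
  "majorant A B R = R powi N * exp ((A / R + R / A + B * R + 1 / (B * R)) / (1 - norm q))"

lemma r0: "r \<noteq> 0"
  using q0 rq by auto

lemma q_powi: "q powi m = r powi (2 * m)"
  using power_int_mult[of r 2 m] rq by simp

lemma norm_q: "norm q = (norm r)\<^sup>2"
  by (simp flip: rq add: norm_power)

text \<open>For \<open>m = int n\<close> the \<alpha>-product is bounded and the \<beta>-product
  grows like \<open>s powi (- int (n * (n - 1)))\<close>; the Gaussian factor reduces this to
  \<open>s powi ((1 - N) * int n)\<close>. For negative \<open>m\<close> the products exchange
  roles. The radii \<open>A\<close> and \<open>B\<close> are positive bounds for the parameters
  because reciprocals of them occur, while \<alpha> and \<beta> may be 0.\<close>

lemma norm_series_term_le:
  assumes "0 < A" "0 < B" "norm \<alpha> \<le> A" "norm \<beta> \<le> B" "w \<noteq> 0"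
  shows "norm (series_term \<alpha> \<beta> m w) \<le> majorant A B (norm w) *
    two_sided_geometric (norm (r powi (1 - N) * B * t)) (norm (r powi (1 + N) * A / t)) m"
proof -
  define s R k where "s = norm r" and "R = norm w" and "k = 1 / (1 - norm q)"
  have pos: "0 < s" "0 < R" "0 < k" "0 < norm t"
    using r0 \<open>w \<noteq> 0\<close> q1 t0 by (auto simp: s_def R_def k_def)
  have bnd: "norm (\<alpha> / w) \<le> A / R" "norm (\<beta> * w) \<le> B * R"
    using assms by (auto simp: R_def norm_divide norm_mult divide_right_mono mult_right_mono)
  have small: "norm (qpoch_inf (q powi (1 + int n) * y) q) \<le> exp (Y * k)" if "norm y \<le> Y" for n y Y
  proof -
    have "norm (q powi (1 + int n) * y) \<le> 1 * Y"
    proof -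
      have "q powi (1 + int n) = q ^ Suc n" by (subst power_int_of_nat[symmetric]) simp
      then have "norm (q powi (1 + int n)) \<le> 1"
        unfolding norm_power using q1 by (simp only: norm_power) (intro power_le_one; simp)
      then show ?thesis using that by (subst norm_mult) (intro mult_mono; simp)
    qed
    then have "exp (norm (q powi (1 + int n) * y) / (1 - norm q)) \<le> exp (Y / (1 - norm q))"
      using q1 by (simp add: divide_right_mono)
    from order_trans[OF norm_qpoch_inf_le[OF q1] this] show ?thesis by (simp add: k_def)
  qed
  have large: "norm (qpoch_inf (q powi (1 - int n) * y) q)
           \<le> Y ^ n * s powi (- int (n * (n - 1))) * exp ((Y + 1 / Y) * k)" if "norm y \<le> Y" "0 < Y" for n y Y
    using norm_qpoch_inf_powi_le[OF q1 q0 that, of s n] pos by (simp add: norm_q s_def k_def)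
  have sq: "int (n * (n - 1)) = int n * int n - int n" for n
    by (cases n) (auto simp: algebra_simps)
  consider n where "m = int n" | n where "m = - int n" by (cases m rule: int_cases2) auto
  then show ?thesis
  proof cases
    case (1 n)
    have "norm (series_term \<alpha> \<beta> m w) \<le>
      exp (A / R * k) * ((B * R) ^ n * s powi (- int (n * (n - 1))) * exp ((B * R + 1 / (B * R)) * k))
        * (norm t ^ n * s powi (int n * int n - N * int n) * R powi (N - int n))"
      unfolding series_term_def norm_mult norm_power_int 1 s_def[symmetric] R_def[symmetric] power_int_of_nat
      by (intro mult_right_mono mult_mono small large bnd) (use pos assms in \<open>auto simp: norm_power\<close>)
    also have "\<dots> = (R ^ n * R powi (N - int n)) * (exp (A / R * k) * exp ((B * R + 1 / (B * R)) * k))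
        * ((B * norm t) ^ n * (s powi (- int (n * (n - 1))) * s powi (int n * int n - N * int n)))"
      by (simp only: power_mult_distrib mult_ac)
    also have "s powi (- int (n * (n - 1))) * s powi (int n * int n - N * int n) = s powi ((1 - N) * int n)"
      using pos by (subst power_int_add[symmetric]) (auto simp: sq algebra_simps)
    also have "R ^ n * R powi (N - int n) = R powi N"
      using pos by (simp add: power_int_diff)
    also have "exp (A / R * k) * exp ((B * R + 1 / (B * R)) * k) = exp ((A / R + B * R + 1 / (B * R)) * k)"
      by (simp add: algebra_simps flip: exp_add)
    also have "(B * norm t) ^ n * s powi ((1 - N) * int n) = norm (r powi (1 - N) * B * t) ^ n"
      using assms by (simp add: norm_mult norm_power_int power_mult_distrib power_int_mult s_def)
    also have "R powi N * exp ((A / R + B * R + 1 / (B * R)) * k) \<le> majorant A B R"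
      using pos assms by (auto simp: majorant_def k_def intro!: mult_left_mono divide_right_mono)
    finally show ?thesis
      by (simp add: 1 two_sided_geometric_def R_def mult_right_mono)
  next
    case (2 n)
    have "norm (series_term \<alpha> \<beta> m w) \<le>
      ((A / R) ^ n * s powi (- int (n * (n - 1))) * exp ((A / R + 1 / (A / R)) * k)) * exp (B * R * k)
        * (norm t powi (- int n) * s powi (int n * int n + N * int n) * R powi (N + int n))"
    proof -
      have eq: "series_term \<alpha> \<beta> m w = qpoch_inf (q powi (1 - int n) * (\<alpha> / w)) q *
          qpoch_inf (q powi (1 + int n) * (\<beta> * w)) q
          * (t powi (- int n) * r powi (int n * int n + N * int n) * w powi (N + int n))"
        by (simp add: series_term_def 2)
      show ?thesis
        unfolding eq norm_mult norm_power_int s_def[symmetric] R_def[symmetric]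
        by (intro mult_right_mono mult_mono small large bnd) (use pos assms in auto)
    qed
    also have "\<dots> = ((A / R) ^ n * R powi (N + int n)) * (exp ((A / R + 1 / (A / R)) * k) * exp (B * R * k))
        * (norm t powi (- int n) * (s powi (- int (n * (n - 1))) * s powi (int n * int n + N * int n)))"
      by (simp only: mult_ac)
    also have "s powi (- int (n * (n - 1))) * s powi (int n * int n + N * int n) = s powi ((1 + N) * int n)"
      using pos by (subst power_int_add[symmetric]) (auto simp: sq algebra_simps)
    also have "(A / R) ^ n * R powi (N + int n) = A ^ n * R powi N"
      using pos by (simp add: power_int_add power_divide)
    also have "exp ((A / R + 1 / (A / R)) * k) * exp (B * R * k) = exp ((A / R + R / A + B * R) * k)"
      by (simp add: algebra_simps flip: exp_add)
    also have "A ^ n * R powi N * exp ((A / R + R / A + B * R) * k)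
        * (norm t powi (- int n) * s powi ((1 + N) * int n))
      = R powi N * exp ((A / R + R / A + B * R) * k) * ((A / norm t) ^ n * s powi ((1 + N) * int n))"
    proof -
      have "norm t powi (- int n) = 1 / norm t ^ n" by (simp add: power_int_minus divide_inverse)
      then show ?thesis by (simp add: power_divide)
    qed
    also have "(A / norm t) ^ n * s powi ((1 + N) * int n) = norm (r powi (1 + N) * A / t) ^ n"
      using assms by (simp add: norm_mult norm_divide norm_power_int power_mult_distrib power_divide power_int_mult s_def)
    also have "R powi N * exp ((A / R + R / A + B * R) * k) \<le> majorant A B R"
      using pos assms by (auto simp: majorant_def k_def intro!: mult_left_mono divide_right_mono)
    finally show ?thesis
      by (auto simp: 2 two_sided_geometric_def R_def mult_right_mono)
  qed
qed

text \<open>The inequalities in \<open>admissible\<close> are strict, which leaves room for positive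
  radii even when a parameter vanishes.\<close>

lemma admissible_radii:
  assumes "admissible \<alpha> \<beta>"
  obtains A B where "0 < A" "0 < B" "norm \<alpha> \<le> A" "norm \<beta> \<le> B"
    "two_sided_geometric (norm (r powi (1 - N) * of_real B * t)) (norm (r powi (1 + N) * of_real A / t))
       summable_on UNIV"
proof -
  have pos: "0 < norm (r powi (1 + N) / t)" "0 < norm (r powi (1 - N) * t)"
    using r0 t0 by auto
  have "norm \<alpha> < 1 / norm (r powi (1 + N) / t)" "norm \<beta> < 1 / norm (r powi (1 - N) * t)"
    using assms r0 t0 unfolding admissible_def
    by (simp_all only: pos_less_divide_eq[OF pos(1)] pos_less_divide_eq[OF pos(2)])
       (simp_all add: norm_mult norm_divide field_simps)
  then obtain A B where AB: "norm \<alpha> < A" "A < 1 / norm (r powi (1 + N) / t)"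
      "norm \<beta> < B" "B < 1 / norm (r powi (1 - N) * t)"
    using dense by metis
  then have "0 < A" "0 < B"
    using norm_ge_zero[of \<alpha>] norm_ge_zero[of \<beta>] by linarith+
  moreover have "norm (r powi (1 - N) * B * t) < 1" "norm (r powi (1 + N) * A / t) < 1"
    using AB(2,4) r0 t0 \<open>0 < A\<close> \<open>0 < B\<close>
    by (simp_all only: pos_less_divide_eq[OF pos(1)] pos_less_divide_eq[OF pos(2)])
       (simp_all add: norm_mult norm_divide field_simps)
  ultimately show ?thesis
    using AB by (intro that[of A B] summable_two_sided_geometric) auto
qed

text \<open>Uniformity in \<open>w\<close> gives holomorphy and termwise integration; uniformity in
  the two parameters gives continuity in them, hence the limits along
  \<open>q ^ n * \<alpha>\<close> and \<open>q ^ n * \<beta>\<close>.\<close>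

lemma admissible_uniform_limit:
  assumes "admissible \<alpha> \<beta>" "compact K" "0 \<notin> K"
  shows "uniform_limit (cball 0 (norm \<alpha>) \<times> cball 0 (norm \<beta>) \<times> K)
    (\<lambda>X (a, b, w). \<Sum>m\<in>X. series_term a b m w) (\<lambda>(a, b, w). series_sum a b w) (finite_subsets_at_top UNIV)"
proof -
  from admissible_radii[OF assms(1)] obtain A B where AB: "0 < A" "0 < B" "norm \<alpha> \<le> A" "norm \<beta> \<le> B"
    and summable: "two_sided_geometric (norm (r powi (1 - N) * of_real B * t))
                     (norm (r powi (1 + N) * of_real A / t)) summable_on UNIV" by blast
  have "continuous_on K (\<lambda>w. majorant A B (norm w))"
    unfolding majorant_def using AB assms(3) q1 by (auto intro!: continuous_intros)
  then have "bounded ((\<lambda>w. majorant A B (norm w)) ` K)"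
    using assms(2) by (intro compact_imp_bounded compact_continuous_image)
  then obtain C where C: "\<And>w. w \<in> K \<Longrightarrow> norm (majorant A B (norm w)) \<le> C"
    by (auto simp: bounded_iff)
  have "uniform_limit (cball 0 (norm \<alpha>) \<times> cball 0 (norm \<beta>) \<times> K)
    (\<lambda>X x. \<Sum>m\<in>X. series_term (fst x) (fst (snd x)) m (snd (snd x)))
    (\<lambda>x. \<Sum>\<^sub>\<infinity>m\<in>UNIV. series_term (fst x) (fst (snd x)) m (snd (snd x))) (finite_subsets_at_top UNIV)"
  proof (rule Weierstrass_m_test_general)
    show "(\<lambda>m. C * two_sided_geometric (norm (r powi (1 - N) * of_real B * t))
                     (norm (r powi (1 + N) * of_real A / t)) m) summable_on UNIV"
      by (intro summable_on_cmult_right summable)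
    fix m and x :: "complex \<times> complex \<times> complex"
    assume x: "x \<in> cball 0 (norm \<alpha>) \<times> cball 0 (norm \<beta>) \<times> K"
    obtain a b w where [simp]: "x = (a, b, w)" by (cases x)
    have "norm (series_term a b m w) \<le> majorant A B (norm w) *
        two_sided_geometric (norm (r powi (1 - N) * of_real B * t)) (norm (r powi (1 + N) * of_real A / t)) m"
      using x assms AB by (intro norm_series_term_le) auto
    also have "\<dots> \<le> C * two_sided_geometric (norm (r powi (1 - N) * of_real B * t))
        (norm (r powi (1 + N) * of_real A / t)) m"
      using C[of w] x by (intro mult_right_mono) (auto simp: two_sided_geometric_def)
    finally show "norm (series_term (fst x) (fst (snd x)) m (snd (snd x))) \<le> \<dots>" by simp
  qed
  then show ?thesis by (simp add: case_prod_unfold series_sum_def)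
qed

lemma admissible_mono:
  assumes "admissible \<alpha> \<beta>" "norm a \<le> norm \<alpha>" "norm b \<le> norm \<beta>"
  shows "admissible a b"
proof -
  have "norm (r powi (1 + N) * a / t) \<le> norm (r powi (1 + N) * \<alpha> / t)"
       "norm (r powi (1 - N) * b * t) \<le> norm (r powi (1 - N) * \<beta> * t)"
    using assms by (auto simp: norm_mult norm_divide intro!: divide_right_mono mult_right_mono mult_left_mono)
  with assms(1) show ?thesis unfolding admissible_def by linarith
qed

lemma series_sum_uniform_limit:
  assumes "admissible \<alpha> \<beta>" "compact K" "0 \<notin> K"
  shows "uniform_limit K (\<lambda>X w. \<Sum>m\<in>X. series_term \<alpha> \<beta> m w) (series_sum \<alpha> \<beta>) (finite_subsets_at_top UNIV)"
proof (rule uniform_limitI)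
  fix e :: real assume "e > 0"
  from uniform_limitD[OF admissible_uniform_limit[OF assms] this]
  show "\<forall>\<^sub>F X in finite_subsets_at_top UNIV.
      \<forall>w\<in>K. dist (\<Sum>m\<in>X. series_term \<alpha> \<beta> m w) (series_sum \<alpha> \<beta> w) < e"
    by eventually_elim force
qed

lemma series_sum_has_sum:
  assumes "admissible \<alpha> \<beta>" "w \<noteq> 0"
  shows "((\<lambda>m. series_term \<alpha> \<beta> m w) has_sum series_sum \<alpha> \<beta> w) UNIV"
  unfolding has_sum_def
  using tendsto_uniform_limitI[OF series_sum_uniform_limit[OF assms(1), of "{w}"]] assms(2) by simp

lemma series_term_holomorphic: "series_term \<alpha> \<beta> m holomorphic_on -{0}"
  unfolding series_term_def
  by (intro holomorphic_on_mult holomorphic_on_qpoch_inf q1 holomorphic_intros) auto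

lemma series_sum_holomorphic:
  assumes "admissible \<alpha> \<beta>"
  shows "series_sum \<alpha> \<beta> holomorphic_on -{0}"
proof -
  have "series_sum \<alpha> \<beta> field_differentiable at z" if "z \<noteq> 0" for z
  proof -
    define e where "e = norm z / 2"
    have e: "e > 0" "cball z e \<subseteq> -{0}"
      using that by (auto simp: e_def)
    have holo: "(\<lambda>w. \<Sum>m\<in>X. series_term \<alpha> \<beta> m w) holomorphic_on cball z e" for X
      by (intro holomorphic_on_sum holomorphic_on_subset[OF series_term_holomorphic e(2)])
    have "series_sum \<alpha> \<beta> holomorphic_on ball z e"
    proof (rule holomorphic_uniform_limit)
      show "uniform_limit (cball z e) (\<lambda>X w. \<Sum>m\<in>X. series_term \<alpha> \<beta> m w) (series_sum \<alpha> \<beta>)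
              (finite_subsets_at_top UNIV)"
        using e by (intro series_sum_uniform_limit assms) auto
      show "\<forall>\<^sub>F X in finite_subsets_at_top UNIV. continuous_on (cball z e) (\<lambda>w. \<Sum>m\<in>X. series_term \<alpha> \<beta> m w)
              \<and> (\<lambda>w. \<Sum>m\<in>X. series_term \<alpha> \<beta> m w) holomorphic_on ball z e"
        using holo by (intro always_eventually allI conjI holomorphic_on_imp_continuous_on
                              holomorphic_on_subset[OF _ ball_subset_cball])
    qed auto
    then show ?thesis using e by (auto simp: holomorphic_on_open field_differentiable_def)
  qed
  then show ?thesis by (auto simp: holomorphic_on_def intro: field_differentiable_at_within)
qed

lemma series_sum_tendsto:
  assumes "admissible \<alpha> \<beta>" "w \<noteq> 0" "a \<longlonglongrightarrow> a0" "b \<longlonglongrightarrow> b0"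
    and a: "\<And>n. norm (a n) \<le> norm \<alpha>" "norm a0 \<le> norm \<alpha>" and b: "\<And>n. norm (b n) \<le> norm \<beta>" "norm b0 \<le> norm \<beta>"
  shows "(\<lambda>n. series_sum (a n) (b n) w) \<longlonglongrightarrow> series_sum a0 b0 w"
proof -
  let ?D = "cball 0 (norm \<alpha>) \<times> cball 0 (norm \<beta>) \<times> {w}"
  have "continuous_on ?D (\<lambda>(a, b, w). series_sum a b w)"
  proof (rule uniform_limit_theorem[OF _ admissible_uniform_limit[OF assms(1)]])
    show "\<forall>\<^sub>F X in finite_subsets_at_top UNIV. continuous_on ?D (\<lambda>(a, b, w). \<Sum>m\<in>X. series_term a b m w)"
      unfolding series_term_def case_prod_unfold using \<open>w \<noteq> 0\<close>
      by (intro always_eventually allI continuous_on_sum continuous_on_mult continuous_on_qpoch_inf[OF q1]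
            continuous_intros) auto
  qed (use \<open>w \<noteq> 0\<close> in auto)
  then have "(\<lambda>n. (\<lambda>(a, b, w). series_sum a b w) (a n, b n, w)) \<longlonglongrightarrow> (\<lambda>(a, b, w). series_sum a b w) (a0, b0, w)"
    by (rule continuous_on_tendsto_compose) (use assms in \<open>auto intro!: tendsto_intros\<close>)
  then show ?thesis by simp
qed

text \<open>Passing from \<open>m\<close> to \<open>m + 1\<close> removes the first factor of the
  \<alpha>-product and adds one to the \<beta>-product, so both terms share \<open>P\<close>,
  \<open>Q\<close> and \<open>e\<close> up to simple factors. The coefficient is chosen to cancel
  the part in \<open>1 / w\<close>, which leaves \<open>1 - q * \<alpha> * \<beta>\<close>.\<close>

lemma series_term_step_left:
  assumes "w \<noteq> 0"
  shows "series_term \<alpha> \<beta> m w - (- (r powi (1 + N)) / t * \<alpha>) * series_term \<alpha> \<beta> (m + 1) w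
           = (1 - q * \<alpha> * \<beta>) * series_term (q * \<alpha>) \<beta> m w"
proof -
  define P where "P = qpoch_inf (q powi (2 + m) * (\<alpha> / w)) q"
  define Q where "Q = qpoch_inf (q powi (1 - m) * (\<beta> * w)) q"
  define e where "e = t powi m * r powi (m * m - N * m) * w powi (N - m)"
  have q2: "q powi (2 + m) = q * q powi (1 + m)" "q powi (1 - m) = q * q powi (- m)"
    using q0 by (simp_all add: power_int_add power_int_diff power_int_minus power2_eq_square field_simps)
  have 1: "series_term \<alpha> \<beta> m w = (1 - q powi (1 + m) * (\<alpha> / w)) * P * Q * e"
    using qpoch_inf_step[OF q1, of "q powi (1 + m) * (\<alpha> / w)"]
    by (simp add: series_term_def P_def Q_def e_def q2 mult_ac)
  have 2: "series_term (q * \<alpha>) \<beta> m w = P * Q * e"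
    by (simp add: series_term_def P_def Q_def e_def q2 mult_ac)
  have "r powi ((m + 1) * (m + 1) - N * (m + 1)) = r powi (m * m - N * m) * r powi (2 * m + 1 - N)"
    using r0 by (subst power_int_add[symmetric]) (auto simp: algebra_simps)
  moreover have "w powi (N - (m + 1)) = w powi (N - m) / w"
    using power_int_diff[of w "N - m" 1] assms by (simp add: algebra_simps)
  ultimately have e': "t powi (m + 1) * r powi ((m + 1) * (m + 1) - N * (m + 1)) * w powi (N - (m + 1))
      = e * (t * r powi (2 * m + 1 - N) / w)"
    using t0 by (simp add: e_def power_int_add)
  have 3: "series_term \<alpha> \<beta> (m + 1) w = P * ((1 - q powi (- m) * (\<beta> * w)) * Q) * (e * (t * r powi (2 * m + 1 - N) / w))"
  proof -
    have "series_term \<alpha> \<beta> (m + 1) w = P * qpoch_inf (q powi (- m) * (\<beta> * w)) q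
      * (t powi (m + 1) * r powi ((m + 1) * (m + 1) - N * (m + 1)) * w powi (N - (m + 1)))"
      by (simp add: series_term_def P_def add.commute)
    then show ?thesis
      unfolding e' using qpoch_inf_step[OF q1, of "q powi (- m) * (\<beta> * w)"] by (simp add: Q_def q2 mult_ac)
  qed
  have "r powi (1 + N) * r powi (2 * m + 1 - N) = q powi (1 + m)"
    using r0 by (subst power_int_add[symmetric]) (auto simp: q_powi algebra_simps)
  then have 4: "- (r powi (1 + N)) / t * (t * r powi (2 * m + 1 - N) / w) = - (q powi (1 + m)) / w"
    using t0 by simp
  have 5: "q powi (1 + m) * q powi (- m) = q"
    using q0 by (subst power_int_add[symmetric]) auto
  have "series_term \<alpha> \<beta> m w - (- (r powi (1 + N)) / t * \<alpha>) * series_term \<alpha> \<beta> (m + 1) w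
    = P * Q * e * (1 - q powi (1 + m) * (\<alpha> / w) -
        (- (r powi (1 + N)) / t * (t * r powi (2 * m + 1 - N) / w)) * \<alpha> * (1 - q powi (- m) * (\<beta> * w)))"
  proof -
    have "(1 - x) * P * Q * e - (\<rho> * \<alpha>) * (P * ((1 - y) * Q) * (e * \<kappa>))
            = P * Q * e * (1 - x - (\<rho> * \<kappa>) * \<alpha> * (1 - y))" for x y \<rho> \<kappa>
      by (simp add: algebra_simps)
    then show ?thesis unfolding 1 3 .
  qed
  also have "\<dots> = P * Q * e * (1 - (q powi (1 + m) * q powi (- m)) * \<alpha> * \<beta>)"
    unfolding 4 using assms by (simp add: field_simps)
  finally show ?thesis unfolding 2 5 by (simp add: mult_ac)
qed

text \<open>In the mirror image, going down to \<open>m - 1\<close> exchanges the roles of the two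
  products, and the coefficient cancels the part linear in \<open>w\<close>.\<close>

lemma series_term_step_right:
  assumes "w \<noteq> 0"
  shows "series_term \<alpha> \<beta> m w - (- (r powi (1 - N)) * t * \<beta>) * series_term \<alpha> \<beta> (m - 1) w
           = (1 - q * \<alpha> * \<beta>) * series_term \<alpha> (q * \<beta>) m w"
proof -
  define P where "P = qpoch_inf (q powi (1 + m) * (\<alpha> / w)) q"
  define Q where "Q = qpoch_inf (q powi (2 - m) * (\<beta> * w)) q"
  define e where "e = t powi m * r powi (m * m - N * m) * w powi (N - m)"
  have q2: "q powi (2 - m) = q * q powi (1 - m)" "q powi (1 + m) = q * q powi m"
    using q0 by (simp_all add: power_int_add power_int_diff power_int_minus power2_eq_square field_simps)
  have 1: "series_term \<alpha> \<beta> m w = P * ((1 - q powi (1 - m) * (\<beta> * w)) * Q) * e"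
    using qpoch_inf_step[OF q1, of "q powi (1 - m) * (\<beta> * w)"]
    by (simp add: series_term_def P_def Q_def e_def q2 mult_ac)
  have 2: "series_term \<alpha> (q * \<beta>) m w = P * Q * e"
    by (simp add: series_term_def P_def Q_def e_def q2 mult_ac)
  have "r powi ((m - 1) * (m - 1) - N * (m - 1)) = r powi (m * m - N * m) * r powi (N + 1 - 2 * m)"
    using r0 by (subst power_int_add[symmetric]) (auto simp: algebra_simps)
  moreover have "w powi (N - (m - 1)) = w powi (N - m) * w"
    using power_int_add[of w "N - m" 1] assms by (simp add: algebra_simps)
  ultimately have e': "t powi (m - 1) * r powi ((m - 1) * (m - 1) - N * (m - 1)) * w powi (N - (m - 1))
      = e * (r powi (N + 1 - 2 * m) * w / t)"
    using t0 by (simp add: e_def power_int_diff)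
  have 3: "series_term \<alpha> \<beta> (m - 1) w = ((1 - q powi m * (\<alpha> / w)) * P) * Q * (e * (r powi (N + 1 - 2 * m) * w / t))"
  proof -
    have "series_term \<alpha> \<beta> (m - 1) w = qpoch_inf (q powi m * (\<alpha> / w)) q * Q
      * (t powi (m - 1) * r powi ((m - 1) * (m - 1) - N * (m - 1)) * w powi (N - (m - 1)))"
      by (simp add: series_term_def Q_def)
    then show ?thesis
      unfolding e' using qpoch_inf_step[OF q1, of "q powi m * (\<alpha> / w)"] by (simp add: P_def q2(2) mult_ac)
  qed
  have "r powi (1 - N) * r powi (N + 1 - 2 * m) = q powi (1 - m)"
    using r0 by (subst power_int_add[symmetric]) (auto simp: q_powi algebra_simps)
  then have 4: "- (r powi (1 - N)) * t * (r powi (N + 1 - 2 * m) * w / t) = - (q powi (1 - m)) * w"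
    using t0 by simp
  have 5: "q powi (1 - m) * q powi m = q"
    using q0 by (subst power_int_add[symmetric]) auto
  have "series_term \<alpha> \<beta> m w - (- (r powi (1 - N)) * t * \<beta>) * series_term \<alpha> \<beta> (m - 1) w
    = P * Q * e * (1 - q powi (1 - m) * (\<beta> * w) -
        (- (r powi (1 - N)) * t * (r powi (N + 1 - 2 * m) * w / t)) * \<beta> * (1 - q powi m * (\<alpha> / w)))"
  proof -
    have "P * ((1 - x) * Q) * e - (\<sigma> * \<beta>) * ((1 - y) * P * Q * (e * \<kappa>))
            = P * Q * e * (1 - x - (\<sigma> * \<kappa>) * \<beta> * (1 - y))" for x y \<sigma> \<kappa>
      by (simp add: algebra_simps)
    then show ?thesis unfolding 1 3 .
  qed
  also have "\<dots> = P * Q * e * (1 - (q powi (1 - m) * q powi m) * \<alpha> * \<beta>)"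
    unfolding 4 using assms by (simp add: field_simps)
  finally show ?thesis unfolding 2 5 by (simp add: mult_ac)
qed

text \<open>A bilateral sum is invariant under an index shift, so both terms of the termwise
  relation sum to multiples of the same number.\<close>

lemma series_sum_step_left:
  assumes "admissible \<alpha> \<beta>" "w \<noteq> 0"
  shows "(1 - (- (r powi (1 + N)) / t * \<alpha>)) * series_sum \<alpha> \<beta> w
           = (1 - q * \<alpha> * \<beta>) * series_sum (q * \<alpha>) \<beta> w"
proof (rule has_sum_unique)
  note S = series_sum_has_sum[OF assms]
  have "((\<lambda>m. series_term \<alpha> \<beta> (m + 1) w) has_sum series_sum \<alpha> \<beta> w) UNIV"
    using S by (subst has_sum_reindex_bij_witness[of UNIV "\<lambda>m. m - 1" "\<lambda>m. m + 1" UNIV]) auto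
  from has_sum_add[OF S has_sum_cmult_right[OF this, of "- z" for z]]
  have "((\<lambda>m. series_term \<alpha> \<beta> m w - z * series_term \<alpha> \<beta> (m + 1) w) has_sum
        (1 - z) * series_sum \<alpha> \<beta> w) UNIV" for z
    by (simp add: left_diff_distrib)
  then show "((\<lambda>m. series_term \<alpha> \<beta> m w - (- (r powi (1 + N)) / t * \<alpha>) * series_term \<alpha> \<beta> (m + 1) w) has_sum
        (1 - (- (r powi (1 + N)) / t * \<alpha>)) * series_sum \<alpha> \<beta> w) UNIV" .
  have "admissible (q * \<alpha>) \<beta>"
    by (rule admissible_mono[OF assms(1)]) (use q1 in \<open>auto simp: norm_mult mult_left_le_one_le\<close>)
  then show "((\<lambda>m. series_term \<alpha> \<beta> m w - (- (r powi (1 + N)) / t * \<alpha>) * series_term \<alpha> \<beta> (m + 1) w) has_sum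
        (1 - q * \<alpha> * \<beta>) * series_sum (q * \<alpha>) \<beta> w) UNIV"
    unfolding series_term_step_left[OF assms(2)] by (intro has_sum_cmult_right series_sum_has_sum assms)
qed

lemma series_sum_step_right:
  assumes "admissible \<alpha> \<beta>" "w \<noteq> 0"
  shows "(1 - (- (r powi (1 - N)) * t * \<beta>)) * series_sum \<alpha> \<beta> w
           = (1 - q * \<alpha> * \<beta>) * series_sum \<alpha> (q * \<beta>) w"
proof (rule has_sum_unique)
  note S = series_sum_has_sum[OF assms]
  have "((\<lambda>m. series_term \<alpha> \<beta> (m - 1) w) has_sum series_sum \<alpha> \<beta> w) UNIV"
    using S by (subst has_sum_reindex_bij_witness[of UNIV "\<lambda>m. m + 1" "\<lambda>m. m - 1" UNIV]) auto
  from has_sum_add[OF S has_sum_cmult_right[OF this, of "- z" for z]]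
  have "((\<lambda>m. series_term \<alpha> \<beta> m w - z * series_term \<alpha> \<beta> (m - 1) w) has_sum
        (1 - z) * series_sum \<alpha> \<beta> w) UNIV" for z
    by (simp add: left_diff_distrib)
  then show "((\<lambda>m. series_term \<alpha> \<beta> m w - (- (r powi (1 - N)) * t * \<beta>) * series_term \<alpha> \<beta> (m - 1) w) has_sum
        (1 - (- (r powi (1 - N)) * t * \<beta>)) * series_sum \<alpha> \<beta> w) UNIV" .
  have "admissible \<alpha> (q * \<beta>)"
    by (rule admissible_mono[OF assms(1)]) (use q1 in \<open>auto simp: norm_mult mult_left_le_one_le\<close>)
  then show "((\<lambda>m. series_term \<alpha> \<beta> m w - (- (r powi (1 - N)) * t * \<beta>) * series_term \<alpha> \<beta> (m - 1) w) has_sum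
        (1 - q * \<alpha> * \<beta>) * series_sum \<alpha> (q * \<beta>) w) UNIV"
    unfolding series_term_step_right[OF assms(2)] by (intro has_sum_cmult_right series_sum_has_sum assms)
qed

lemma norm_q_power_mult_le: "norm (q ^ n * x) \<le> norm x"
  using q1 by (simp add: norm_mult norm_power mult_left_le_one_le power_le_one)

lemma q_power_mult_tendsto_0: "(\<lambda>n. q ^ n * x) \<longlonglongrightarrow> 0"
  by (rule tendsto_mult_left_zero) (rule LIMSEQ_power_zero[OF q1])

text \<open>Driving \<alpha> to 0 first produces the product in
  \<open>q * \<alpha> * \<beta>\<close>; with \<alpha> = 0 the corresponding factor of the second
  recursion is 1, so the iteration in \<beta> contributes only one product.\<close>

lemma series_sum_eq:
  assumes "admissible \<alpha> \<beta>" "w \<noteq> 0"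
  shows "qpoch_inf (- (r powi (1 + N)) / t * \<alpha>) q * qpoch_inf (- (r powi (1 - N)) * t * \<beta>) q * series_sum \<alpha> \<beta> w
           = qpoch_inf (q * \<alpha> * \<beta>) q * series_sum 0 0 w"
proof -
  have adm: "admissible (q ^ n * \<alpha>) \<beta>" "admissible 0 (q ^ n * \<beta>)" for n
    using admissible_mono[OF assms(1) norm_q_power_mult_le order_refl]
          admissible_mono[OF assms(1) _ norm_q_power_mult_le] by auto
  have "(1 - (- (r powi (1 + N)) / t * \<alpha>) * q ^ n) * series_sum (q ^ n * \<alpha>) \<beta> w
        = (1 - (q * \<alpha> * \<beta>) * q ^ n) * series_sum (q ^ Suc n * \<alpha>) \<beta> w" for n
    using series_sum_step_left[OF adm(1) assms(2), of n] by (simp add: mult_ac)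
  moreover have "(\<lambda>n. series_sum (q ^ n * \<alpha>) \<beta> w) \<longlonglongrightarrow> series_sum 0 \<beta> w"
    by (rule series_sum_tendsto[OF assms]) (auto simp: norm_q_power_mult_le q_power_mult_tendsto_0)
  ultimately have 1: "qpoch_inf (- (r powi (1 + N)) / t * \<alpha>) q * series_sum \<alpha> \<beta> w
      = qpoch_inf (q * \<alpha> * \<beta>) q * series_sum 0 \<beta> w"
    using qpoch_inf_recursion[OF q1, of "- (r powi (1 + N)) / t * \<alpha>" "\<lambda>n. series_sum (q ^ n * \<alpha>) \<beta> w"] by simp
  have "(1 - (- (r powi (1 - N)) * t * \<beta>) * q ^ n) * series_sum 0 (q ^ n * \<beta>) w
        = (1 - 0 * q ^ n) * series_sum 0 (q ^ Suc n * \<beta>) w" for n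
    using series_sum_step_right[OF adm(2) assms(2), of n] by (simp add: mult_ac)
  moreover have "(\<lambda>n. series_sum 0 (q ^ n * \<beta>) w) \<longlonglongrightarrow> series_sum 0 0 w"
    by (rule series_sum_tendsto[OF assms]) (auto simp: norm_q_power_mult_le q_power_mult_tendsto_0)
  ultimately have 2: "qpoch_inf (- (r powi (1 - N)) * t * \<beta>) q * series_sum 0 \<beta> w = series_sum 0 0 w"
    using qpoch_inf_recursion[OF q1, of "- (r powi (1 - N)) * t * \<beta>" "\<lambda>n. series_sum 0 (q ^ n * \<beta>) w" 0]
    by (simp add: qpoch_inf_0[OF q1])
  have "qpoch_inf (- (r powi (1 + N)) / t * \<alpha>) q * qpoch_inf (- (r powi (1 - N)) * t * \<beta>) q * series_sum \<alpha> \<beta> w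
      = qpoch_inf (- (r powi (1 - N)) * t * \<beta>) q * (qpoch_inf (- (r powi (1 + N)) / t * \<alpha>) q * series_sum \<alpha> \<beta> w)"
    by (simp only: mult_ac)
  also have "\<dots> = qpoch_inf (q * \<alpha> * \<beta>) q * series_sum 0 0 w"
    unfolding 1 2[symmetric] by (simp only: mult_ac)
  finally show ?thesis .
qed

section \<open>The theta series\<close>

lemma admissible_0: "admissible 0 0"
  by (simp add: admissible_def)

text \<open>This is the quasi-periodicity of a theta function: the exponent of \<open>r\<close> is
  quadratic in \<open>m\<close>, so multiplying \<open>w\<close> by \<open>q\<close> amounts to an
  index shift up to a monomial in \<open>w\<close>.\<close>

lemma theta_shift:
  assumes "w \<noteq> 0"
  shows "series_sum 0 0 (q * w) = t * r powi (N - 1) / w * series_sum 0 0 w"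
proof (rule has_sum_unique)
  have "series_term 0 0 m (q * w) = t * r powi (N - 1) / w * series_term 0 0 (m - 1) w" for m
  proof -
    have 1: "q powi (N - m) = r powi (2 * N - 2 * m)"
      by (simp add: q_powi algebra_simps)
    have 2: "r powi (m * m - N * m) * r powi (2 * N - 2 * m)
        = r powi (N - 1) * r powi ((m - 1) * (m - 1) - N * (m - 1))"
      using r0 by (subst (1 2) power_int_add[symmetric]) (auto simp: algebra_simps)
    have 3: "w powi (N - (m - 1)) = w * w powi (N - m)"
      using power_int_add[of w "N - m" 1] assms by (simp add: algebra_simps)
    have 4: "t powi m = t * t powi (m - 1)"
      using t0 by (simp add: power_int_diff)
    have "series_term 0 0 m (q * w) = t powi m * (r powi (m * m - N * m) * q powi (N - m)) * w powi (N - m)"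
      by (simp add: series_term_def qpoch_inf_0[OF q1] power_int_mult_distrib)
    also have "\<dots> = t * r powi (N - 1) / w * series_term 0 0 (m - 1) w"
      unfolding 1 2 3 4 using assms by (simp add: series_term_def qpoch_inf_0[OF q1] 3)
    finally show ?thesis .
  qed
  moreover have "((\<lambda>m. series_term 0 0 (m - 1) w) has_sum series_sum 0 0 w) UNIV"
    using series_sum_has_sum[OF admissible_0 assms]
    by (subst has_sum_reindex_bij_witness[of UNIV "\<lambda>m. m + 1" "\<lambda>m. m - 1" UNIV]) auto
  ultimately show "((\<lambda>m. series_term 0 0 m (q * w)) has_sum t * r powi (N - 1) / w * series_sum 0 0 w) UNIV"
    by (simp only:) (rule has_sum_cmult_right)
  show "((\<lambda>m. series_term 0 0 m (q * w)) has_sum series_sum 0 0 (q * w)) UNIV"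
    using assms q0 by (intro series_sum_has_sum admissible_0) auto
qed

section \<open>The integral of the theta series\<close>

lemma separates_contour_integrable:
  assumes "separates q c d g" "f holomorphic_on regular_set q c d"
  shows "f contour_integrable_on g"
  using assms open_regular_set[OF q0 q1]
  by (intro contour_integrable_holomorphic_simple[of f "regular_set q c d"]) (auto simp: separates_def[OF q0 q1])

lemma polynomial_contour_integral_tendsto:
  fixes f :: "'b \<Rightarrow> complex \<Rightarrow> complex"
  assumes "polynomial_function g" "uniform_limit (path_image g) f l F" "F \<noteq> bot"
    and "\<forall>\<^sub>F n in F. f n contour_integrable_on g"
  shows "((\<lambda>n. contour_integral g (f n)) \<longlongrightarrow> contour_integral g l) F"
proof -
  obtain B where "\<And>t. t \<in> {0..1} \<Longrightarrow> norm (vector_derivative g (at t)) \<le> B"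
    using polynomial_function_vector_derivative_bounded[OF assms(1)] by blast
  then show ?thesis
    using assms by (intro contour_integral_uniform_limit(2)) (auto simp: valid_path_polynomial_function)
qed

text \<open>On a bounded range \<open>q ^ n * p w\<close> is uniformly small, and the reciprocal of
  the product is continuous at 0 with value 1. The relevant \<open>p\<close> are
  \<open>d / w\<close> and \<open>c * w\<close>.\<close>

lemma uniform_limit_inverse_qpoch_inf:
  assumes "bounded (p ` K)"
  shows "uniform_limit K (\<lambda>n w. inverse (qpoch_inf (q ^ n * p w) q)) (\<lambda>_. 1) sequentially"
proof (rule uniform_limitI)
  fix e :: real assume "e > 0"
  obtain C where C: "C > 0" "\<And>w. w \<in> K \<Longrightarrow> norm (p w) \<le> C"
    using assms unfolding bounded_pos by auto
  have "((\<lambda>x. inverse (qpoch_inf x q)) \<longlongrightarrow> inverse 1) (at 0)"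
    by (intro tendsto_inverse tendsto_qpoch_inf_0[OF q1] tendsto_ident_at) auto
  then obtain \<delta> where \<delta>: "\<delta> > 0" "\<And>x. norm x < \<delta> \<Longrightarrow> dist (inverse (qpoch_inf x q)) 1 < e"
    using \<open>e > 0\<close> qpoch_inf_0[OF q1] unfolding LIM_def by (metis dist_0_norm dist_commute dist_self inverse_1)
  have "(\<lambda>n. norm q ^ n * C) \<longlonglongrightarrow> 0"
    using q1 by (intro tendsto_mult_left_zero LIMSEQ_power_zero) auto
  then have "\<forall>\<^sub>F n in sequentially. norm q ^ n * C < \<delta>"
    using \<open>\<delta> > 0\<close> by (rule order_tendstoD)
  then show "\<forall>\<^sub>F n in sequentially. \<forall>w\<in>K. dist (inverse (qpoch_inf (q ^ n * p w) q)) 1 < e"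
  proof eventually_elim
    case (elim n)
    have "norm (q ^ n * p w) < \<delta>" if "w \<in> K" for w
    proof -
      have "norm (q ^ n * p w) \<le> norm q ^ n * C"
        using C(2)[OF that] by (simp add: norm_mult norm_power mult_left_mono)
      with elim show ?thesis by linarith
    qed
    then show ?case using \<delta>(2) by blast
  qed
qed

section \<open>The theta integral and its recursions\<close>

definition kernel :: "complex \<Rightarrow> complex \<Rightarrow> complex \<Rightarrow> complex" where
  "kernel c d w = inverse (qpoch_inf (c * w) q) * inverse (qpoch_inf (d / w) q) / w"

definition theta_integral :: "complex \<Rightarrow> complex \<Rightarrow> (real \<Rightarrow> complex) \<Rightarrow> complex" where
  "theta_integral c d g = contour_integral g (\<lambda>w. series_sum 0 0 w * kernel c d w)"

lemma kernel_holomorphic: "kernel c d holomorphic_on regular_set q c d"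
  unfolding kernel_def regular_set_def[OF q0 q1]
  by (intro holomorphic_on_mult holomorphic_on_divide holomorphic_on_inverse
        holomorphic_on_qpoch_inf[OF q1] holomorphic_intros) auto

lemma series_term_holomorphic_regular: "series_term \<alpha> \<beta> m holomorphic_on regular_set q c d"
  by (rule holomorphic_on_subset[OF series_term_holomorphic]) (auto simp: regular_set_def[OF q0 q1])

lemma series_sum_holomorphic_regular:
  "admissible \<alpha> \<beta> \<Longrightarrow> series_sum \<alpha> \<beta> holomorphic_on regular_set q c d"
  by (rule holomorphic_on_subset[OF series_sum_holomorphic]) (auto simp: regular_set_def[OF q0 q1])

lemma theta_kernel_holomorphic:
  "(\<lambda>w. series_sum 0 0 w * kernel c d w) holomorphic_on regular_set q c d"
  by (intro holomorphic_on_mult kernel_holomorphic series_sum_holomorphic_regular admissible_0)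

lemma termwise_contour_integral:
  assumes g: "separates q c d g" "polynomial_function g" and adm: "admissible \<alpha> \<beta>"
  shows "((\<lambda>m. contour_integral g (\<lambda>w. series_term \<alpha> \<beta> m w * kernel c d w)) has_sum
           contour_integral g (\<lambda>w. series_sum \<alpha> \<beta> w * kernel c d w)) UNIV"
proof -
  have sub: "path_image g \<subseteq> regular_set q c d"
    using g by (simp add: separates_def[OF q0 q1])
  then have 0: "0 \<notin> path_image g" by (auto simp: regular_set_def[OF q0 q1])
  have comp: "compact (path_image g)"
    using g by (simp add: separates_def[OF q0 q1] compact_path_image valid_path_imp_path)
  have bdd: "bounded (f ` path_image g)" if "f holomorphic_on regular_set q c d" for f :: "complex \<Rightarrow> complex"
    using comp that sub
    by (meson compact_continuous_image compact_imp_bounded continuous_on_subset holomorphic_on_imp_continuous_on)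
  have int: "(\<lambda>w. series_term \<alpha> \<beta> m w * kernel c d w) contour_integrable_on g" for m
    by (rule separates_contour_integrable[OF g(1)])
       (intro holomorphic_on_mult kernel_holomorphic series_term_holomorphic_regular)
  have "uniform_limit (path_image g) (\<lambda>X w. (\<Sum>m\<in>X. series_term \<alpha> \<beta> m w) * kernel c d w)
          (\<lambda>w. series_sum \<alpha> \<beta> w * kernel c d w) (finite_subsets_at_top UNIV)"
    by (intro uniform_lim_mult series_sum_uniform_limit adm comp 0 uniform_limit_const bdd
          series_sum_holomorphic_regular kernel_holomorphic)
  then have "((\<lambda>X. contour_integral g (\<lambda>w. (\<Sum>m\<in>X. series_term \<alpha> \<beta> m w) * kernel c d w)) \<longlongrightarrow>
          contour_integral g (\<lambda>w. series_sum \<alpha> \<beta> w * kernel c d w)) (finite_subsets_at_top UNIV)"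
    by (rule polynomial_contour_integral_tendsto[OF g(2)])
       (auto intro!: always_eventually separates_contour_integrable[OF g(1)] holomorphic_on_mult
          holomorphic_on_sum kernel_holomorphic series_term_holomorphic_regular)
  moreover have "\<forall>\<^sub>F X in finite_subsets_at_top UNIV.
      contour_integral g (\<lambda>w. (\<Sum>m\<in>X. series_term \<alpha> \<beta> m w) * kernel c d w)
      = (\<Sum>m\<in>X. contour_integral g (\<lambda>w. series_term \<alpha> \<beta> m w * kernel c d w))"
    by (intro eventually_finite_subsets_at_top_weakI) (simp add: sum_distrib_right contour_integral_sum int)
  ultimately show ?thesis
    unfolding has_sum_def by (rule Lim_transform_eventually)
qed

text \<open>Both \<open>f\<close> and its dilate \<open>h\<close> are explicit multiples of
  \<open>Z\<close>, by the first factors of the q-products and by \<open>theta_shift\<close>. As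
  \<open>f\<close> and \<open>h\<close> have equal integrals, it suffices that the difference of the
  two sides is the integral of a multiple of \<open>f - h\<close>.\<close>

lemma theta_integral_step_inner:
  assumes g: "separates q c d g" and "d \<noteq> 0"
  shows "(1 - c * d) * theta_integral c d g = (1 - (- (r powi (1 - N)) / t * d)) * theta_integral c (q * d) g"
proof -
  define u where "u = - (r powi (1 - N)) / t"
  \<comment> \<open>\<open>\<kappa> / w\<close> is the multiplier of the theta series under
    \<open>w \<mapsto> q * w\<close>, and \<open>u\<close> is the negative reciprocal of
    \<open>\<kappa>\<close>.\<close>
  define \<kappa> where "\<kappa> = t * r powi (N - 1)"
  have "r powi (1 - N) * r powi (N - 1) = 1"
    using r0 by (subst power_int_add[symmetric]) auto
  then have u\<kappa>: "u * \<kappa> = -1" using t0 by (simp add: u_def \<kappa>_def)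
  define f where "f = (\<lambda>w. series_sum 0 0 w * kernel c (q * d) w)"
  define Z where "Z = (\<lambda>w. series_sum 0 0 w * kernel c d w)"
  define h where "h = (\<lambda>w. \<kappa> * (1 - c * w) / w * Z w)"
  have rel: "f w = (1 - d / w) * Z w" "q * f (q * w) = h w" if w: "w \<in> regular_set q c d" for w
  proof -
    have w0: "w \<noteq> 0" using w by (simp add: regular_set_def[OF q0 q1])
    have nz: "qpoch_inf (c * w) q \<noteq> 0" "qpoch_inf (d / w) q \<noteq> 0"
      using w by (auto simp: regular_set_def[OF q0 q1])
    have 1: "qpoch_inf (d / w) q = (1 - d / w) * qpoch_inf (q * d / w) q"
            "qpoch_inf (c * w) q = (1 - c * w) * qpoch_inf (c * (q * w)) q"
      using qpoch_inf_step[OF q1, of "d / w"] qpoch_inf_step[OF q1, of "c * w"] by (simp_all add: mult_ac)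
    have 2: "inverse (qpoch_inf (q * d / w) q) = (1 - d / w) * inverse (qpoch_inf (d / w) q)"
            "inverse (qpoch_inf (c * (q * w)) q) = (1 - c * w) * inverse (qpoch_inf (c * w) q)"
      using nz unfolding 1 by simp_all
    show "f w = (1 - d / w) * Z w"
      unfolding f_def Z_def kernel_def 2 by simp
    have 3: "q * d / (q * w) = d / w" using q0 by simp
    have "q * f (q * w) = q * (\<kappa> / w * series_sum 0 0 w *
        ((1 - c * w) * inverse (qpoch_inf (c * w) q) * inverse (qpoch_inf (d / w) q) / (q * w)))"
      unfolding f_def kernel_def 2 3 theta_shift[OF w0] \<kappa>_def by simp
    also have "\<dots> = h w" using q0 by (simp add: h_def Z_def kernel_def)
    finally show "q * f (q * w) = h w" .
  qed
  have reg: "regular_set q c d \<subseteq> regular_set q c (q * d)"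
    by (rule regular_set_mult_q[OF q0 q1])
  have holf: "f holomorphic_on regular_set q c (q * d)"
    unfolding f_def by (rule theta_kernel_holomorphic)
  have holZ: "Z holomorphic_on regular_set q c d"
    unfolding Z_def by (rule theta_kernel_holomorphic)
  have holh: "h holomorphic_on regular_set q c d"
    unfolding h_def by (intro holomorphic_intros holZ) (auto simp: regular_set_def[OF q0 q1])
  have path: "w \<in> regular_set q c d" if "w \<in> path_image g" for w
    using separates_regular[OF q0 q1 g that] .
  have "contour_integral g h = contour_integral g (\<lambda>w. q * f (q * w))"
    by (intro contour_integral_eq) (simp add: rel path)
  \<comment> \<open>Dilating the integrand for \<open>q * d\<close> by \<open>q\<close> leads to the
    parameters \<open>q * c\<close> and \<open>d\<close>. The contour separates the poles in both
    situations, since each arises from \<open>c\<close>, \<open>d\<close> by deleting a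
    pole.\<close>
  also have "\<dots> = contour_integral g f"
    using g holf q0 separates_mult_q[OF q0 q1, of c d g]
    by (intro separates_contour_integral_shift[OF q0 q1, of c "q * d"]) auto
  finally have hf: "contour_integral g h = contour_integral g f" .
  have intf: "f contour_integrable_on g"
    using separates_contour_integrable[OF g holomorphic_on_subset[OF holf reg]] .
  have ints: "(Z has_contour_integral contour_integral g Z) g" "(h has_contour_integral contour_integral g f) g"
    "(f has_contour_integral contour_integral g f) g"
    using separates_contour_integrable[OF g holZ] separates_contour_integrable[OF g holh] intf hf
    by (metis has_contour_integral_integral)+
  have A: "((\<lambda>w. (1 - c * d) * Z w - (1 - u * d) * f w) has_contour_integral
      (1 - c * d) * contour_integral g Z - (1 - u * d) * contour_integral g f) g"
    by (intro has_contour_integral_diff has_contour_integral_lmul ints)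
  have B: "((\<lambda>w. u * d * (f w - h w)) has_contour_integral u * d * (contour_integral g f - contour_integral g f)) g"
    by (intro has_contour_integral_diff has_contour_integral_lmul ints)
  have "u * d * (f w - h w) = (1 - c * d) * Z w - (1 - u * d) * f w" if "w \<in> path_image g" for w
  proof -
    have w0: "w \<noteq> 0" using path[OF that] by (simp add: regular_set_def[OF q0 q1])
    have "u * d * (f w - h w) = u * d * f w - (u * \<kappa>) * d * ((1 - c * w) / w) * Z w"
      by (simp add: h_def algebra_simps)
    also have "\<dots> = (1 - c * d) * Z w - (1 - u * d) * f w"
      unfolding u\<kappa> rel(1)[OF path[OF that]] using w0 by (simp add: field_simps)
    finally show ?thesis .
  qed
  then have "((\<lambda>w. (1 - c * d) * Z w - (1 - u * d) * f w) has_contour_integral 0) g"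
    using has_contour_integral_eq[OF B] by simp
  with A have "(1 - c * d) * contour_integral g Z - (1 - u * d) * contour_integral g f = 0"
    by (rule has_contour_integral_unique)
  then show ?thesis by (simp add: theta_integral_def Z_def f_def u_def)
qed

text \<open>The counterpart for the outer poles uses the dilation by \<open>1 / q\<close>. With
  \<open>d = 0\<close> the factor \<open>1 - c * d\<close> is 1, and the dilated integrand is simply
  a multiple of \<open>w * Z w\<close>.\<close>

lemma theta_integral_step_outer:
  assumes g: "separates q c 0 g"
  shows "theta_integral c 0 g = (1 - (- (r powi (1 + N)) * t * c)) * theta_integral (q * c) 0 g"
proof -
  define v where "v = - (r powi (1 + N)) * t"
  define \<kappa> where "\<kappa> = t * r powi (N - 1)"
  have "r powi (N - 1) * q = r powi (1 + N)"
    using r0 power_int_add[of r "N - 1" 2] by (simp add: rq add.commute)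
  then have v\<kappa>: "\<kappa> * q = - v" by (simp add: v_def \<kappa>_def)
  have v0: "v \<noteq> 0" using t0 r0 by (simp add: v_def)
  define f where "f = (\<lambda>w. series_sum 0 0 w * kernel (q * c) 0 w)"
  define Z where "Z = (\<lambda>w. series_sum 0 0 w * kernel c 0 w)"
  define h where "h = (\<lambda>w. - (w / v) * Z w)"
  have rel: "f w = (1 - c * w) * Z w" "1 / q * f (1 / q * w) = h w" if w: "w \<in> regular_set q c 0" for w
  proof -
    have w0: "w \<noteq> 0" using w by (simp add: regular_set_def[OF q0 q1])
    have nz: "qpoch_inf (c * w) q \<noteq> 0"
      using w by (auto simp: regular_set_def[OF q0 q1])
    have 1: "qpoch_inf (c * w) q = (1 - c * w) * qpoch_inf (q * c * w) q"
      using qpoch_inf_step[OF q1, of "c * w"] by (simp_all add: mult_ac)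
    have 2: "inverse (qpoch_inf (q * c * w) q) = (1 - c * w) * inverse (qpoch_inf (c * w) q)"
      using nz unfolding 1 by simp
    show "f w = (1 - c * w) * Z w"
      unfolding f_def Z_def kernel_def 2 by simp
    have "series_sum 0 0 w = \<kappa> / (w / q) * series_sum 0 0 (w / q)"
      using theta_shift[of "w / q"] w0 q0 by (simp add: \<kappa>_def)
    also have "\<kappa> / (w / q) = - v / w" using v\<kappa> by simp
    finally have 3: "series_sum 0 0 (w / q) = - (w / v) * series_sum 0 0 w"
      using v0 w0 by simp
    have 4: "q * c * (w / q) = c * w" using q0 by simp
    show "1 / q * f (1 / q * w) = h w"
      using q0 w0 by (simp add: f_def h_def Z_def kernel_def 3 4 qpoch_inf_0[OF q1])
  qed
  have reg: "regular_set q c 0 \<subseteq> regular_set q (q * c) 0"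
    by (rule regular_set_mult_q[OF q0 q1])
  have holf: "f holomorphic_on regular_set q (q * c) 0"
    unfolding f_def by (rule theta_kernel_holomorphic)
  have holZ: "Z holomorphic_on regular_set q c 0"
    unfolding Z_def by (rule theta_kernel_holomorphic)
  have holh: "h holomorphic_on regular_set q c 0"
    unfolding h_def using v0 by (intro holomorphic_intros holZ) auto
  have path: "w \<in> regular_set q c 0" if "w \<in> path_image g" for w
    using separates_regular[OF q0 q1 g that] .
  have "contour_integral g h = contour_integral g (\<lambda>w. 1 / q * f (1 / q * w))"
    by (intro contour_integral_eq) (simp only: rel path)
  also have "\<dots> = contour_integral g f"
    using g holf q0 separates_mult_q[OF q0 q1, of c 0 g]
    by (intro separates_contour_integral_shift[OF q0 q1, of "q * c" 0]) auto
  finally have hf: "contour_integral g h = contour_integral g f" .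
  have intf: "f contour_integrable_on g"
    using separates_contour_integrable[OF g holomorphic_on_subset[OF holf reg]] .
  have ints: "(Z has_contour_integral contour_integral g Z) g" "(h has_contour_integral contour_integral g f) g"
    "(f has_contour_integral contour_integral g f) g"
    using separates_contour_integrable[OF g holZ] separates_contour_integrable[OF g holh] intf hf
    by (metis has_contour_integral_integral)+
  have A: "((\<lambda>w. Z w - (1 - v * c) * f w) has_contour_integral
      contour_integral g Z - (1 - v * c) * contour_integral g f) g"
    by (intro has_contour_integral_diff has_contour_integral_lmul ints)
  have B: "((\<lambda>w. c * v * (f w - h w)) has_contour_integral c * v * (contour_integral g f - contour_integral g f)) g"
    by (intro has_contour_integral_diff has_contour_integral_lmul ints)
  have "c * v * (f w - h w) = Z w - (1 - v * c) * f w" if "w \<in> path_image g" for w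
    unfolding h_def rel(1)[OF path[OF that]] using v0 by (simp add: field_simps)
  then have "((\<lambda>w. Z w - (1 - v * c) * f w) has_contour_integral 0) g"
    using has_contour_integral_eq[OF B] by simp
  with A have "contour_integral g Z - (1 - v * c) * contour_integral g f = 0"
    by (rule has_contour_integral_unique)
  then show ?thesis by (simp add: theta_integral_def Z_def f_def v_def)
qed

section \<open>Iteration down to the constant coefficient\<close>

lemma separates_q_power:
  assumes "separates q c d g"
  shows "separates q (q ^ n * c) d g" "separates q c (q ^ n * d) g"
proof -
  show "separates q (q ^ n * c) d g"
    by (induction n) (use assms separates_mult_q(1)[OF q0 q1] in \<open>auto simp: mult.assoc\<close>)
  show "separates q c (q ^ n * d) g"
    by (induction n) (use assms separates_mult_q(2)[OF q0 q1] in \<open>auto simp: mult.assoc\<close>)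
qed

text \<open>The contour is fixed, and the kernel differs from its limit by a factor tending to 1
  uniformly on the path.\<close>

lemma theta_integral_tendsto:
  assumes g: "separates q c d g" "polynomial_function g"
  shows "(\<lambda>n. theta_integral c (q ^ n * d) g) \<longlonglongrightarrow> theta_integral c 0 g"
    and "(\<lambda>n. theta_integral (q ^ n * c) 0 g) \<longlonglongrightarrow> theta_integral 0 0 g"
proof -
  have sub: "path_image g \<subseteq> regular_set q c d"
    using g by (simp add: separates_def[OF q0 q1])
  then have w0: "\<And>w. w \<in> path_image g \<Longrightarrow> w \<noteq> 0" by (auto simp: regular_set_def[OF q0 q1])
  have comp: "compact (path_image g)"
    using g by (simp add: separates_def[OF q0 q1] compact_path_image valid_path_imp_path)
  have bdd: "bounded (f ` path_image g)" if "continuous_on (path_image g) f" for f :: "complex \<Rightarrow> complex"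
    using comp that by (intro compact_imp_bounded compact_continuous_image)
  have *: "(\<lambda>n. contour_integral g (\<lambda>w. f w * inverse (qpoch_inf (q ^ n * p w) q))) \<longlonglongrightarrow> contour_integral g f"
    if f: "f holomorphic_on regular_set q c' d'" and sep: "separates q c' d' g"
    and int: "\<And>n. (\<lambda>w. f w * inverse (qpoch_inf (q ^ n * p w) q)) contour_integrable_on g"
    and p: "continuous_on (path_image g) p" for f p c' d'
  proof -
    have "continuous_on (path_image g) f"
      using f sep by (meson continuous_on_subset holomorphic_on_imp_continuous_on separates_def[OF q0 q1])
    then have "uniform_limit (path_image g) (\<lambda>n w. f w * inverse (qpoch_inf (q ^ n * p w) q)) (\<lambda>w. f w * 1) sequentially"
      by (intro uniform_lim_mult uniform_limit_const uniform_limit_inverse_qpoch_inf bdd p continuous_on_const)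
    from polynomial_contour_integral_tendsto[OF g(2) this] int show ?thesis by simp
  qed
  have sep0: "separates q c 0 g" "separates q 0 0 g"
    using separates_0[OF q0 q1] g by blast+
  have eq1: "series_sum 0 0 w * kernel c (q ^ n * d) w
      = series_sum 0 0 w * kernel c 0 w * inverse (qpoch_inf (q ^ n * (d / w)) q)" for n w
    by (simp add: kernel_def qpoch_inf_0[OF q1])
  have eq2: "series_sum 0 0 w * kernel (q ^ n * c) 0 w
      = series_sum 0 0 w * kernel 0 0 w * inverse (qpoch_inf (q ^ n * (c * w)) q)" for n w
    by (simp add: kernel_def qpoch_inf_0[OF q1] mult.assoc)
  show "(\<lambda>n. theta_integral c (q ^ n * d) g) \<longlonglongrightarrow> theta_integral c 0 g"
    unfolding theta_integral_def eq1
  proof (rule *[OF theta_kernel_holomorphic sep0(1)])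
    show "continuous_on (path_image g) (\<lambda>w. d / w)"
      using w0 by (intro continuous_intros) auto
    fix n
    show "(\<lambda>w. series_sum 0 0 w * kernel c 0 w * inverse (qpoch_inf (q ^ n * (d / w)) q)) contour_integrable_on g"
      unfolding eq1[symmetric]
      by (rule separates_contour_integrable[OF separates_q_power(2)[OF g(1)] theta_kernel_holomorphic])
  qed
  show "(\<lambda>n. theta_integral (q ^ n * c) 0 g) \<longlonglongrightarrow> theta_integral 0 0 g"
    unfolding theta_integral_def eq2
  proof (rule *[OF theta_kernel_holomorphic sep0(2)])
    show "continuous_on (path_image g) (\<lambda>w. c * w)"
      by (intro continuous_intros)
    fix n
    show "(\<lambda>w. series_sum 0 0 w * kernel 0 0 w * inverse (qpoch_inf (q ^ n * (c * w)) q)) contour_integrable_on g"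
      unfolding eq2[symmetric]
      by (rule separates_contour_integrable[OF separates_q_power(1)[OF sep0(1)] theta_kernel_holomorphic])
  qed
qed

lemma contour_integral_powi:
  assumes "valid_path g" "pathfinish g = pathstart g" "0 \<notin> path_image g"
  shows "contour_integral g (\<lambda>w. w powi k) = (if k = -1 then 2 * of_real pi * \<i> * winding_number g 0 else 0)"
proof (cases "k = -1")
  case True
  then show ?thesis
    using assms winding_number_valid_path[of g 0] by (simp add: power_int_minus inverse_eq_divide)
next
  case False
  have "((\<lambda>w. w powi k) has_contour_integral 0) g"
  proof (rule Cauchy_theorem_primitive[of "-{0}" "\<lambda>w. w powi (k + 1) / of_int (k + 1)"])
    fix w :: complex assume "w \<in> -{0}"
    moreover have "of_int (k + 1) \<noteq> (0 :: complex)"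
      using False by (subst of_int_eq_0_iff) auto
    ultimately show "((\<lambda>w. w powi (k + 1) / of_int (k + 1)) has_field_derivative w powi k) (at w within -{0})"
      by (auto intro!: derivative_eq_intros simp del: of_int_add)
  qed (use assms in auto)
  then show ?thesis using False by (simp add: contour_integral_unique)
qed

text \<open>Without q-products the kernel is \<open>1 / w\<close>, so only \<open>m = N\<close>
  contributes; the exponent of \<open>r\<close> is 0 there.\<close>

lemma theta_integral_0_0:
  assumes g: "separates q 0 0 g" "polynomial_function g"
  shows "theta_integral 0 0 g = 2 * of_real pi * \<i> * t powi N"
proof -
  have g': "valid_path g" "pathfinish g = pathstart g" "0 \<notin> path_image g" "winding_number g 0 = 1"
    using g by (auto simp: separates_def[OF q0 q1] regular_set_def[OF q0 q1])
  have "contour_integral g (\<lambda>w. series_term 0 0 m w * kernel 0 0 w)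
      = (if m = N then 2 * of_real pi * \<i> * t powi N else 0)" for m
  proof -
    have "contour_integral g (\<lambda>w. series_term 0 0 m w * kernel 0 0 w)
      = contour_integral g (\<lambda>w. t powi m * r powi (m * m - N * m) * w powi (N - m - 1))"
    proof (rule contour_integral_eq)
      fix w assume "w \<in> path_image g"
      with g'(3) have "w \<noteq> 0" by auto
      then have "w powi (N - m - 1) = w powi (N - m) / w"
        using power_int_diff[of w "N - m" 1] by simp
      then show "series_term 0 0 m w * kernel 0 0 w = t powi m * r powi (m * m - N * m) * w powi (N - m - 1)"
        by (simp add: series_term_def kernel_def qpoch_inf_0[OF q1])
    qed
    also have "\<dots> = t powi m * r powi (m * m - N * m) * contour_integral g (\<lambda>w. w powi (N - m - 1))"
      using g by (intro contour_integral_lmul separates_contour_integrable[OF g(1)])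
        (auto intro!: holomorphic_intros simp: regular_set_def[OF q0 q1])
    also have "\<dots> = (if m = N then 2 * of_real pi * \<i> * t powi N else 0)"
      using g' by (auto simp: contour_integral_powi)
    finally show ?thesis .
  qed
  with termwise_contour_integral[OF g admissible_0]
  have "((\<lambda>m. if m = N then 2 * of_real pi * \<i> * t powi N else 0) has_sum theta_integral 0 0 g) UNIV"
    by (simp add: theta_integral_def)
  moreover have "((\<lambda>m. if m = N then 2 * of_real pi * \<i> * t powi N else 0) has_sum 2 * of_real pi * \<i> * t powi N) UNIV"
    by (rule has_sum_finite_neutralI[of "{N}"]) auto
  ultimately show ?thesis by (rule has_sum_unique)
qed

lemma theta_integral_eq:
  assumes g: "separates q c d g" "polynomial_function g" and "d \<noteq> 0"
  shows "qpoch_inf (c * d) q * theta_integral c d g =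
    2 * of_real pi * \<i> * t powi N * qpoch_inf (- (r powi (1 + N)) * t * c) q * qpoch_inf (- (r powi (1 - N)) / t * d) q"
proof -
  have "(1 - c * d * q ^ n) * theta_integral c (q ^ n * d) g
     = (1 - (- (r powi (1 - N)) / t * d) * q ^ n) * theta_integral c (q ^ Suc n * d) g" for n
    using theta_integral_step_inner[OF separates_q_power(2)[OF g(1)], of n] q0 \<open>d \<noteq> 0\<close> by (simp add: mult_ac)
  from qpoch_inf_recursion[OF q1, of "c * d" "\<lambda>n. theta_integral c (q ^ n * d) g", OF this theta_integral_tendsto(1)[OF g]]
  have 1: "qpoch_inf (c * d) q * theta_integral c d g
      = qpoch_inf (- (r powi (1 - N)) / t * d) q * theta_integral c 0 g"
    by simp
  have sep0: "separates q c 0 g" "separates q 0 0 g"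
    using separates_0[OF q0 q1] g by blast+
  have "(1 - 0 * q ^ n) * theta_integral (q ^ n * c) 0 g
     = (1 - (- (r powi (1 + N)) * t * c) * q ^ n) * theta_integral (q ^ Suc n * c) 0 g" for n
    using theta_integral_step_outer[OF separates_q_power(1)[OF sep0(1)], of n] by (simp add: mult_ac)
  from qpoch_inf_recursion[OF q1, of 0 "\<lambda>n. theta_integral (q ^ n * c) 0 g", OF this theta_integral_tendsto(2)[OF g]]
  have 2: "theta_integral c 0 g = qpoch_inf (- (r powi (1 + N)) * t * c) q * (2 * of_real pi * \<i> * t powi N)"
    by (simp add: qpoch_inf_0[OF q1] theta_integral_0_0[OF sep0(2) g(2)])
  show ?thesis unfolding 1 2 by (simp only: mult_ac)
qed

section \<open>The integrals of the statement\<close>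

text \<open>Every zero of the denominator is one of the listed poles, with
  \<open>r powi m * c\<close> and \<open>r powi (- m) * d\<close> as the parameters for index
  \<open>m\<close>.\<close>

lemma separating_contour_imp_separates:
  assumes "separating_contour (inner_poles q r d m) (outer_poles q r c m) g"
  shows "separates q (r powi m * c) (r powi (- m) * d) g"
proof -
  note g = assms[unfolded separating_contour_def]
  have g_nz: "w \<noteq> 0" if "w \<in> path_image g" for w using g that by auto
  have inner: "w \<in> inner_poles q r d m" if "qpoch_inf (r powi (- m) * d / w) q = 0" for w
  proof -
    from that obtain k where k: "r powi (- m) * d / w * q ^ k = 1"
      by (auto simp: qpoch_inf_eq_0_iff[OF q1])
    \<comment> \<open>For \<open>w = 0\<close> the quotient would be 0 by convention, not 1.\<close>
    then have "w \<noteq> 0" by auto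
    with k have "w = r powi (- m) * q ^ k * d" by (simp add: field_simps)
    then show ?thesis unfolding inner_poles_def by blast
  qed
  have outer: "w \<in> outer_poles q r c m" if "qpoch_inf (r powi m * c * w) q = 0" for w
  proof -
    from that obtain k where k: "r powi m * c * w * q ^ k = 1"
      by (auto simp: qpoch_inf_eq_0_iff[OF q1])
    then have "c \<noteq> 0" by auto
    have "r powi (- m) * inverse (q ^ k) / c = r powi (- m) * inverse (q ^ k) / c * (r powi m * c * w * q ^ k)"
      unfolding k by simp
    also have "\<dots> = (r powi (- m) * r powi m) * w"
      using \<open>c \<noteq> 0\<close> q0 by simp
    also have "r powi (- m) * r powi m = 1"
      using r0 by (simp add: power_int_minus)
    finally have "w = r powi (- m) * inverse (q ^ k) / c" by simp
    then show ?thesis unfolding outer_poles_def by blast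
  qed
  have "path_image g \<subseteq> regular_set q (r powi m * c) (r powi (- m) * d)"
  proof
    fix w assume w: "w \<in> path_image g"
    then have "w \<notin> inner_poles q r d m" "w \<notin> outer_poles q r c m" using g by blast+
    with inner[of w] outer[of w] g_nz[OF w]
    show "w \<in> regular_set q (r powi m * c) (r powi (- m) * d)"
      unfolding regular_set_def[OF q0 q1] by blast
  qed
  then show ?thesis
    unfolding separates_def[OF q0 q1] using g inner outer by blast
qed

definition integrand :: "complex \<Rightarrow> complex \<Rightarrow> complex \<Rightarrow> complex \<Rightarrow> int \<Rightarrow> complex \<Rightarrow> complex" where
  "integrand a b c d m z =
     qpoch_inf (r powi (2 + m) / (a * z)) q * qpoch_inf (r powi (2 - m) * z / b) q
     / (qpoch_inf (r powi m * c * z) q * qpoch_inf (r powi (- m) * d / z) q)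
     * t powi m * z powi (N - m) * (1 / (2 * of_real pi * \<i> * z))"

lemma integrand_holomorphic:
  assumes "a \<noteq> 0" "b \<noteq> 0"
  shows "integrand a b c d m holomorphic_on regular_set q (r powi m * c) (r powi (- m) * d)"
  unfolding integrand_def regular_set_def[OF q0 q1] using assms
  by (intro holomorphic_on_mult holomorphic_on_divide holomorphic_on_qpoch_inf[OF q1] holomorphic_intros) auto

text \<open>The half-integer powers cancel in the denominator and double up to integer powers of
  \<open>q\<close> in the numerator.\<close>

lemma integrand_scale:
  assumes "w \<noteq> 0"
  shows "r powi (- m) * integrand a b c d m (r powi (- m) * w)
           = 1 / (2 * of_real pi * \<i>) * (series_term (1 / a) (1 / b) m w * kernel c d w)"
proof -
  have nz: "r powi m \<noteq> 0" using r0 by simp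
  have q: "q powi (1 + m) = r powi (2 + m) * r powi m" "q powi (1 - m) = r powi (2 - m) * r powi (- m)"
    using r0 by (simp_all add: q_powi algebra_simps flip: power_int_add)
  have 1: "r powi (2 + m) / (a * (r powi (- m) * w)) = q powi (1 + m) * (1 / a / w)"
    unfolding q using nz r0 by (simp add: power_int_minus field_simps)
  have 2: "r powi (2 - m) * (r powi (- m) * w) / b = q powi (1 - m) * (1 / b * w)"
    unfolding q by simp
  have 3: "r powi m * c * (r powi (- m) * w) = c * w"
    using nz r0 by (simp add: power_int_minus field_simps)
  have 4: "r powi (- m) * d / (r powi (- m) * w) = d / w"
    using nz r0 by (simp add: power_int_minus)
  have "(r powi (- m)) powi (N - m) = r powi (- m * (N - m))"
    by (simp only: power_int_mult)
  also have "- m * (N - m) = m * m - N * m"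
    by (simp add: algebra_simps)
  finally have 5: "(r powi (- m) * w) powi (N - m) = r powi (m * m - N * m) * w powi (N - m)"
    by (simp add: power_int_mult_distrib)
  have 6: "r powi (- m) * (1 / (2 * of_real pi * \<i> * (r powi (- m) * w))) = 1 / (2 * of_real pi * \<i>) / w"
    using nz r0 by (simp add: power_int_minus)
  have "r powi (- m) * integrand a b c d m (r powi (- m) * w)
    = qpoch_inf (q powi (1 + m) * (1 / a / w)) q * qpoch_inf (q powi (1 - m) * (1 / b * w)) q
     / (qpoch_inf (c * w) q * qpoch_inf (d / w) q)
     * t powi m * (r powi (m * m - N * m) * w powi (N - m))
     * (r powi (- m) * (1 / (2 * of_real pi * \<i> * (r powi (- m) * w))))"
    unfolding integrand_def 1 2 3 4 5 by (simp only: mult_ac)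
  also have "\<dots> = 1 / (2 * of_real pi * \<i>) * (series_term (1 / a) (1 / b) m w * kernel c d w)"
    unfolding 6 unfolding series_term_def kernel_def divide_inverse inverse_mult_distrib by (simp only: mult_ac mult_1_left)
  finally show ?thesis .
qed

text \<open>The given contours for different \<open>m\<close> are unrelated. Each may be replaced by
  the image of the common \<open>g\<close> under multiplication by \<open>r powi (- m)\<close>,
  which separates the same poles.\<close>

lemma contour_integral_integrand:
  assumes nz: "a \<noteq> 0" "b \<noteq> 0"
    and g: "separates q c d g" and h: "separates q (r powi m * c) (r powi (- m) * d) h"
  shows "contour_integral h (integrand a b c d m) =
    1 / (2 * of_real pi * \<i>) * contour_integral g (\<lambda>w. series_term (1 / a) (1 / b) m w * kernel c d w)"
proof -
  let ?l = "r powi (- m)"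
  have "?l \<noteq> 0" using r0 by simp
  from separates_scale[OF q0 q1 g this]
  have "separates q (r powi m * c) (?l * d) (\<lambda>x. ?l * g x)"
    using r0 by (simp add: power_int_minus field_simps)
  from separates_contour_integral_eq[OF q0 q1 h this integrand_holomorphic[OF nz]]
  have "contour_integral h (integrand a b c d m) = contour_integral (\<lambda>x. ?l * g x) (integrand a b c d m)" .
  also have "\<dots> = contour_integral g (\<lambda>w. ?l * integrand a b c d m (?l * w))"
    using g by (intro contour_integral_scale) (simp add: separates_def[OF q0 q1])
  also have "\<dots> = contour_integral g (\<lambda>w. 1 / (2 * of_real pi * \<i>) * (series_term (1 / a) (1 / b) m w * kernel c d w))"
    using separates_regular[OF q0 q1 g]
    by (intro contour_integral_eq integrand_scale) (auto simp: regular_set_def[OF q0 q1])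
  also have "\<dots> = 1 / (2 * of_real pi * \<i>) * contour_integral g (\<lambda>w. series_term (1 / a) (1 / b) m w * kernel c d w)"
    by (intro contour_integral_lmul separates_contour_integrable[OF g]
          holomorphic_on_mult kernel_holomorphic series_term_holomorphic_regular)
  finally show ?thesis .
qed

lemma integrand_has_sum:
  assumes nonzero: "a \<noteq> 0" "b \<noteq> 0" "d \<noteq> 0"
    and generic: "qpoch_inf (c * d) q \<noteq> 0"
    and adm: "admissible (1 / a) (1 / b)"
    and contour: "\<And>m. separates q (r powi m * c) (r powi (- m) * d) (\<gamma> m)"
  shows "((\<lambda>m. contour_integral (\<gamma> m) (integrand a b c d m)) has_sum
     t powi N
       * (qpoch_inf (q / (a * b)) q * qpoch_inf (- (r powi (1 + N)) * c * t) q * qpoch_inf (- (r powi (1 - N)) * d / t) q)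
       / (qpoch_inf (c * d) q * qpoch_inf (- (r powi (1 + N)) / (a * t)) q * qpoch_inf (- (r powi (1 - N)) * t / b) q)) UNIV"
proof -
  \<comment> \<open>For \<open>m = 0\<close> the powers of \<open>r\<close> are 1, so the given
    contour at index 0 already separates the poles for \<open>c\<close> and \<open>d\<close>; a
    polynomial version of it is the common contour.\<close>
  obtain g where g: "polynomial_function g" "separates q c d g"
    using separates_polynomial_function[OF q0 q1, of c d "\<gamma> 0"] contour[of 0] by auto
  define P where "P = qpoch_inf (- (r powi (1 + N)) / (a * t)) q * qpoch_inf (- (r powi (1 - N)) * t / b) q"
  define R where "R = qpoch_inf (q / (a * b)) q"
  \<comment> \<open>Admissibility bounds the moduli of both arguments by 1, so no factor
    vanishes.\<close>
  have "P \<noteq> 0"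
    using adm unfolding P_def admissible_def
    by (intro no_zero_divisors qpoch_inf_nonzero[OF q1]) (simp_all add: norm_mult norm_divide mult_ac)
  have S: "series_sum (1 / a) (1 / b) w = R / P * series_sum 0 0 w" if "w \<noteq> 0" for w
    using series_sum_eq[OF adm that] \<open>P \<noteq> 0\<close> by (simp add: P_def R_def field_simps)
  have "contour_integral g (\<lambda>w. series_sum (1 / a) (1 / b) w * kernel c d w)
      = contour_integral g (\<lambda>w. R / P * (series_sum 0 0 w * kernel c d w))"
    using separates_regular[OF q0 q1 g(2)]
    by (intro contour_integral_eq) (auto simp: S regular_set_def[OF q0 q1])
  also have "\<dots> = R / P * theta_integral c d g"
    unfolding theta_integral_def
    by (intro contour_integral_lmul separates_contour_integrable[OF g(2)] theta_kernel_holomorphic)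
  finally have "1 / (2 * of_real pi * \<i>) * contour_integral g (\<lambda>w. series_sum (1 / a) (1 / b) w * kernel c d w)
     = R / P * (theta_integral c d g / (2 * of_real pi * \<i>))"
    by simp
  also have "theta_integral c d g / (2 * of_real pi * \<i>) = t powi N * (qpoch_inf (- (r powi (1 + N)) * c * t) q
      * qpoch_inf (- (r powi (1 - N)) * d / t) q) / qpoch_inf (c * d) q"
    using theta_integral_eq[OF g(2,1) nonzero(3)] generic by (simp add: field_simps)
  also have "R / P * (t powi N * (qpoch_inf (- (r powi (1 + N)) * c * t) q
      * qpoch_inf (- (r powi (1 - N)) * d / t) q) / qpoch_inf (c * d) q) = t powi N
       * (R * qpoch_inf (- (r powi (1 + N)) * c * t) q * qpoch_inf (- (r powi (1 - N)) * d / t) q)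
       / (qpoch_inf (c * d) q * P)"
    by (simp add: mult_ac)
  finally have "1 / (2 * of_real pi * \<i>) * contour_integral g (\<lambda>w. series_sum (1 / a) (1 / b) w * kernel c d w)
     = t powi N
       * (R * qpoch_inf (- (r powi (1 + N)) * c * t) q * qpoch_inf (- (r powi (1 - N)) * d / t) q)
       / (qpoch_inf (c * d) q * P)" .
  moreover have "((\<lambda>m. contour_integral (\<gamma> m) (integrand a b c d m)) has_sum
      1 / (2 * of_real pi * \<i>) * contour_integral g (\<lambda>w. series_sum (1 / a) (1 / b) w * kernel c d w)) UNIV"
    unfolding contour_integral_integrand[OF nonzero(1,2) g(2) contour]
    by (intro has_sum_cmult_right termwise_contour_integral g adm)
  ultimately show ?thesis by (simp add: P_def R_def mult.assoc)
qed

end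

theorem proposition4p4:
  fixes q r a b c d t :: complex and N :: int and \<gamma> :: "int \<Rightarrow> real \<Rightarrow> complex"
  assumes q: "0 < norm q" "norm q < 1"
    and r: "r ^ 2 = q"
    and nonzero: "a \<noteq> 0" "b \<noteq> 0" "c \<noteq> 0" "d \<noteq> 0" "t \<noteq> 0"
    and generic: "\<And>n::nat. c * d \<noteq> q powi (- int n)"
    and t: "norm (r powi (N + 1) * inverse a) < norm t" "norm t < norm (r powi (N - 1) * b)"
    and contour: "\<And>m. separating_contour (inner_poles q r d m) (outer_poles q r c m) (\<gamma> m)"
  shows "((\<lambda>m::int. contour_integral (\<gamma> m) (\<lambda>z.
             qpoch_inf (r powi (2 + m) / (a * z)) q * qpoch_inf (r powi (2 - m) * z / b) q
             / (qpoch_inf (r powi m * c * z) q * qpoch_inf (r powi (- m) * d / z) q)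
             * t powi m * z powi (N - m) * (1 / (2 * of_real pi * \<i> * z))))
          has_sum
          (t powi N
             * (qpoch_inf (q / (a * b)) q * qpoch_inf (- (r powi (1 + N)) * c * t) q
                * qpoch_inf (- (r powi (1 - N)) * d / t) q)
             / (qpoch_inf (c * d) q * qpoch_inf (- (r powi (1 + N)) / (a * t)) q
                * qpoch_inf (- (r powi (1 - N)) * t / b) q))) UNIV"
proof -
  have q0: "q \<noteq> 0" and q1: "norm q < 1" and r0: "r \<noteq> 0" using q r by auto
  note ctx = q0 q1 r nonzero(5)
  \<comment> \<open>Genericity enters here: it makes the division by
    \<open>qpoch_inf (c * d) q\<close> legitimate.\<close>
  have "c * d * q ^ k \<noteq> 1" for k
    using generic[of k] q0 by (auto simp: power_int_minus field_simps)
  then have cd: "qpoch_inf (c * d) q \<noteq> 0"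
    by (simp add: qpoch_inf_eq_0_iff[OF q1])
  have adm: "admissible r t N (1 / a) (1 / b)"
  proof -
    have "norm (r powi (1 + N) * (1 / a) / t) < 1"
      using t(1) nonzero by (simp add: norm_mult norm_divide norm_inverse add.commute field_simps)
    moreover have "norm (r powi (1 - N) * (1 / b) * t) < 1"
    proof -
      have "r powi (N - 1) * r powi (1 - N) = 1"
        using r0 by (subst power_int_add[symmetric]) auto
      then have 1: "norm (r powi (N - 1)) * norm (r powi (1 - N)) = 1"
        by (metis norm_mult norm_one)
      have "norm t * norm (r powi (1 - N)) < norm (r powi (N - 1) * b) * norm (r powi (1 - N))"
        using t(2) r0 by (intro mult_strict_right_mono) auto
      also have "\<dots> = norm b"
        using 1 by (simp only: norm_mult mult_ac mult_1_right)
      finally show ?thesis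
        using nonzero by (simp add: norm_mult norm_divide field_simps)
    qed
    ultimately show ?thesis by (simp add: admissible_def[OF ctx])
  qed
  have sep: "separates q (r powi m * c) (r powi (- m) * d) (\<gamma> m)" for m
    by (rule separating_contour_imp_separates[OF ctx contour])
  show ?thesis
    using integrand_has_sum[OF ctx nonzero(1,2,4) cd adm sep] unfolding integrand_def[OF ctx] .
qed

end
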